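(* Let $\psi_2 = \sup_{0\le x\le 1} \frac{1+x+x^3}{1+x^2+x^4} = 1.239\ldots$. For every fixed $k \in \mathbb{N}$, $k\ge 1$, we have $$\chi(\mathbb{R}^n, \triangle^k) \ge \big(\psi_2^{1/(k+1)}+o(1)\big)^n \quad \text{as } n\to\infty,$$ where $\triangle^k$ is the set of all $k+1$ vertices of a regular $k$-dimensional simplex with unit side length. In particular, $\chi(\mathbb{R}^n,\triangle^2) \ge (1.0742\ldots+o(1))^n$ and $\chi(\mathbb{R}^n,\triangle^3) \ge (1.0551\ldots+o(1))^n$, where $1.0742\ldots=\psi_2^{1/3}$ and $1.0551\ldots=\psi_2^{1/4}$.
   Context: For a set $\mathcal{M}\subset\mathbb{R}^d$, the chromatic number $\chi(\mathbb{R}^n,\mathcal{M})$ is the smallest $r$ such that there exists a coloring of the points of the Euclidean space $\mathbb{R}^n$ with $r$ colors and with no monochromatic isometric copy of $\mathcal{M}$ (a copy is a subset of $\mathbb{R}^n$ isometric to $\mathcal{M}$ in the Euclidean metric). The $o(1)$ terms are with respect to $n\to\infty$ with $k$ fixed. *)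

theory Defs
  imports "HOL-Analysis.Analysis" "HOL-Library.Landau_Symbols"
begin

text \<open>
  Since the dimension \<open>n\<close> tends to infinity, \<open>\<real>\<^sup>n\<close> is represented by the carrier of the library's
  \<^const>\<open>Euclidean_space\<close>: the functions \<open>nat \<Rightarrow> real\<close> vanishing at all indices \<open>i \<ge> n\<close>.
\<close>

abbreviation Rn :: "nat \<Rightarrow> (nat \<Rightarrow> real) set" where
  "Rn n \<equiv> topspace (Euclidean_space n)"

definition edist :: "nat \<Rightarrow> (nat \<Rightarrow> real) \<Rightarrow> (nat \<Rightarrow> real) \<Rightarrow> real" where
  "edist n x y = L2_set (\<lambda>i. x i - y i) {..<n}"

definition isometric_copy ::
  "nat \<Rightarrow> (nat \<Rightarrow> real) set \<Rightarrow> nat \<Rightarrow> (nat \<Rightarrow> real) set \<Rightarrow> bool" where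
  "isometric_copy d M n S \<longleftrightarrow>
     S \<subseteq> Rn n \<and>
     (\<exists>f. bij_betw f M S \<and> (\<forall>x\<in>M. \<forall>y\<in>M. edist n (f x) (f y) = edist d x y))"

definition proper_coloring ::
  "nat \<Rightarrow> nat \<Rightarrow> (nat \<Rightarrow> real) set \<Rightarrow> nat \<Rightarrow> ((nat \<Rightarrow> real) \<Rightarrow> nat) \<Rightarrow> bool" where
  "proper_coloring n d M r c \<longleftrightarrow>
     (\<forall>x\<in>Rn n. c x < r) \<and>
     \<not> (\<exists>S. isometric_copy d M n S \<and> (\<exists>j. \<forall>x\<in>S. c x = j))"

text \<open>
  The chromatic number \<open>\<chi>(\<real>\<^sup>n, M)\<close> of \<open>M \<subseteq> \<real>\<^sup>d\<close>; its value is \<open>\<infinity>\<close> if no finite number of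
  colors suffices, and otherwise the infimum is the least such number.
\<close>

definition chromatic_number :: "nat \<Rightarrow> nat \<Rightarrow> (nat \<Rightarrow> real) set \<Rightarrow> enat" where
  "chromatic_number n d M = Inf {enat r |r. \<exists>c. proper_coloring n d M r c}"

text \<open>
  Vertex sets in \<open>\<real>\<^sup>d\<close> of regular \<open>k\<close>-dimensional simplices with unit side length.
  Affine independence need not be required: it follows from the distance condition.
\<close>

definition unit_regular_simplex :: "nat \<Rightarrow> nat \<Rightarrow> (nat \<Rightarrow> real) set \<Rightarrow> bool" where
  "unit_regular_simplex k d M \<longleftrightarrow>
     M \<subseteq> Rn d \<and> card M = k + 1 \<and> pairwise (\<lambda>x y. edist d x y = 1) M"

lemma unit_regular_simplex_standard:
  "unit_regular_simplex k (Suc k) ((\<lambda>i j. if j = i then 1 / sqrt 2 else 0) ` {..k})"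
proof -
  let ?v = "\<lambda>i j::nat. if j = i then 1 / sqrt 2 else (0::real)"
  have "inj_on ?v {..k}"
    by (rule inj_onI) (auto simp: fun_eq_iff split: if_splits)
  moreover have "edist (Suc k) (?v a) (?v b) = 1" if "a \<le> k" "b \<le> k" "a \<noteq> b" for a b
  proof -
    have "(\<Sum>i<Suc k. (?v a i - ?v b i)\<^sup>2)
        = (\<Sum>i<Suc k. (if i = a then 1/2 else 0) + (if i = b then 1/2 else 0))"
      using that by (intro sum.cong) (auto simp: power_divide)
    also have "\<dots> = 1"
      using that by (simp only: sum.distrib sum.delta finite_lessThan) simp
    finally show ?thesis
      by (simp add: edist_def L2_set_def)
  qed
  ultimately show ?thesis
    by (auto simp: unit_regular_simplex_def topspace_Euclidean_space card_image pairwise_def)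
qed

definition psi2 :: real where
  "psi2 = (SUP x\<in>{0..1}. (1 + x + x ^ 3) / (1 + x\<^sup>2 + x ^ 4))"

text \<open>\<open>f(n) \<ge> (a + o(1))\<^sup>n\<close> as \<open>n \<rightarrow> \<infinity>\<close>.\<close>

definition exp_lower_bound :: "(nat \<Rightarrow> enat) \<Rightarrow> real \<Rightarrow> bool" where
  "exp_lower_bound f a \<longleftrightarrow>
     (\<exists>\<epsilon> :: nat \<Rightarrow> real. \<epsilon> \<in> o(\<lambda>_. 1) \<and>
        (\<forall>\<^sub>F n in sequentially. ereal ((a + \<epsilon> n) ^ n) \<le> ereal_of_enat (f n)))"

end

theory Submission
  imports
    Defs
    "HOL-Complex_Analysis.Complex_Analysis"
    "HOL-Probability.Sinc_Integral"
    "HOL-Number_Theory.Prime_Powers"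
    "HOL-Library.FuncSet"
begin

text \<open>
  Let \<open>V\<close> be the vectors in \<open>{-1, 0, 1}\<^sup>m\<close> with \<open>a\<close> ones and \<open>b\<close> minus ones, where \<open>a + 3 b < 2 q\<close> for a
  prime power \<open>q\<close>. By the Frankl-Wilson method, a subset of \<open>V\<close> without squared distance \<open>2 q\<close> has at
  most as many elements as there are monomials of degree less than \<open>q\<close> with exponents at most 2. For
  the best \<open>(a, b)\<close> and \<open>q\<close> close to \<open>(a + 3 b) / 2\<close>, the density of such a subset is at most
  \<open>(psi2 - o(1))\<^bsup>-m\<^esup>\<close>.

  If a subset \<open>A\<close> of \<open>V\<^bsup>k+1\<^esup>\<close> has more than \<open>k + 1\<close> times that density, then some \<open>x \<in> A\<close> is such
  that for every \<open>i\<close> the \<open>i\<close>-th block of \<open>x\<close> can be replaced by some \<open>y\<^sub>i\<close> at squared distance \<open>2 q\<close>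
  without leaving \<open>A\<close>. The \<open>k + 1\<close> points obtained in this way pairwise differ in exactly two blocks,
  hence they have pairwise squared distance \<open>4 q\<close> and form a regular simplex in dimension \<open>(k + 1) m\<close>.

  That a prime power exists in \<open>(x, (1 + \<epsilon>) x]\<close> for all large \<open>x\<close> follows from the non-vanishing of the
  zeta function on the line \<open>Re s = 1\<close>: integrate its logarithmic derivative along this line against
  a weight whose Fourier transform (Selberg's minorant of an interval) is non-positive outside
  \<open>[-\<epsilon>, \<epsilon>]\<close>. If there were no prime power near \<open>exp y\<close>, the integral would be non-positive, but it
  tends to a positive limit as \<open>y\<close> grows, by the Riemann-Lebesgue lemma.
\<close>

section \<open>The zeta function on the line of real part one\<close>

text \<open>Mean value inequality along the segment: the derivative
  \<open>- s * z powr (- s - 1)\<close> is largest in modulus at the left end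
  \<open>a\<close>.\<close>

lemma norm_powr_diff_le:
  fixes s :: complex and a b :: real
  assumes "0 < a" "a \<le> b" "0 \<le> Re s"
  shows "norm (of_real a powr (-s) - of_real b powr (-s)) \<le> norm s * a powr (- Re s - 1) * (b - a)"
proof -
  have "norm (of_real b powr (-s) - of_real a powr (-s)) \<le> (norm s * a powr (- Re s - 1)) * norm (complex_of_real b - of_real a)"
  proof (rule field_differentiable_bound[where S = "closed_segment (complex_of_real a) (of_real b)"
        and f' = "\<lambda>z. - s * z powr (- s - 1)"])
    fix z assume "z \<in> closed_segment (complex_of_real a) (complex_of_real b)"
    then obtain x where x: "z = of_real x" "x \<in> closed_segment a b"
      by (auto simp: closed_segment_of_real)
    then have x': "a \<le> x" using assms by (auto simp: closed_segment_eq_real_ivl)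
    then have "z \<notin> \<real>\<^sub>\<le>\<^sub>0" using x assms by auto
    then show "((\<lambda>z. z powr (-s)) has_field_derivative - s * z powr (- s - 1)) (at z within closed_segment (complex_of_real a) (of_real b))"
      by (rule has_field_derivative_at_within[OF has_field_derivative_powr])
    have "norm (- s * z powr (- s - 1)) = norm s * x powr (- Re s - 1)"
      using x x' assms by (simp add: norm_mult norm_powr_real_powr)
    also have "\<dots> \<le> norm s * a powr (- Re s - 1)"
      using x' assms by (intro mult_left_mono powr_mono2') auto
    finally show "norm (- s * z powr (- s - 1)) \<le> norm s * a powr (- Re s - 1)" .
  qed auto
  also have "norm (complex_of_real b - of_real a) = b - a"
    using assms by (metis abs_of_nonneg diff_ge_0_iff_ge norm_of_real of_real_diff)
  finally show ?thesis by (simp add: norm_minus_commute)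
qed

text \<open>With \<open>N = n + 1\<close>, this is \<open>s - 1\<close> times the difference between
  \<open>N powr (-s)\<close> and the integral of \<open>x powr (-s)\<close> over
  \<open>[N, N + 1]\<close>, with the integral evaluated so that nothing is divided by
  \<open>s - 1\<close>.\<close>

definition zeta_term :: "nat \<Rightarrow> complex \<Rightarrow> complex" where
  "zeta_term n s = (s - 1) * of_nat (Suc n) powr (-s) - of_nat (Suc n) powr (1 - s)
     + of_nat (Suc (Suc n)) powr (1 - s)"

text \<open>The term is the increment over \<open>[N, N + 1]\<close> of a function with derivative
  \<open>(s - 1) * (N powr (-s) - z powr (-s))\<close>, which the preceding lemma bounds. This gains
  one power of \<open>N\<close> over the Dirichlet series, enough for convergence when
  \<open>Re s > 0\<close>.\<close>

lemma norm_zeta_term_le: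
  assumes "0 \<le> Re s"
  shows "norm (zeta_term n s) \<le> norm (s - 1) * norm s * real (Suc n) powr (- Re s - 1)"
proof -
  define a where "a = real (Suc n)"
  have a: "a > 0" by (simp add: a_def)
  let ?f = "\<lambda>z. (s - 1) * z * of_real a powr (-s) + z powr (1 - s)"
  have "norm (?f (of_real (a+1)) - ?f (of_real a)) \<le> (norm (s - 1) * norm s * a powr (- Re s - 1)) * norm (complex_of_real (a+1) - of_real a)"
  proof (rule field_differentiable_bound[where S = "closed_segment (complex_of_real a) (of_real (a+1))"
        and f' = "\<lambda>z. (s - 1) * (of_real a powr (-s) - z powr (- s))"])
    fix z assume "z \<in> closed_segment (complex_of_real a) (complex_of_real (a+1))"
    then obtain x where x: "z = of_real x" "x \<in> closed_segment a (a+1)"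
      by (auto simp only: closed_segment_of_real)
    then have x': "a \<le> x" "x \<le> a + 1" by (auto simp: closed_segment_eq_real_ivl)
    then have "z \<notin> \<real>\<^sub>\<le>\<^sub>0" using x a by auto
    then show "(?f has_field_derivative (s - 1) * (of_real a powr (-s) - z powr (- s))) (at z within closed_segment (complex_of_real a) (of_real (a+1)))"
      by (auto intro!: derivative_eq_intros simp: algebra_simps)
    have "norm (of_real a powr (-s) - of_real x powr (-s)) \<le> norm s * a powr (- Re s - 1) * (x - a)"
      using a x' assms by (intro norm_powr_diff_le) auto
    also have "\<dots> \<le> norm s * a powr (- Re s - 1) * 1"
      using x' by (intro mult_left_mono) auto
    finally have "norm (s - 1) * norm (of_real a powr (-s) - z powr (-s)) \<le> norm (s - 1) * (norm s * a powr (- Re s - 1))"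
      unfolding x by (intro mult_left_mono) auto
    then show "norm ((s - 1) * (of_real a powr (-s) - z powr (- s))) \<le> norm (s - 1) * norm s * a powr (- Re s - 1)"
      by (simp add: norm_mult mult.assoc)
  qed auto
  moreover have "?f (of_real (a+1)) - ?f (of_real a) = zeta_term n s"
    by (simp add: zeta_term_def a_def algebra_simps)
  ultimately show ?thesis by (simp add: a_def)
qed

text \<open>This is \<open>(s - 1) \<zeta>(s)\<close>, continued to \<open>Re s > 0\<close>.\<close>

definition zeta_pole_free :: "complex \<Rightarrow> complex" where
  "zeta_pole_free s = 1 + (\<Sum>n. zeta_term n s)"

lemma summable_Suc_powr:
  assumes "a < -1"
  shows "summable (\<lambda>n. real (Suc n) powr a)"
  using assms summable_real_powr_iff[of a] summable_Suc_iff[of "\<lambda>n. real n powr a"] by simp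

lemma norm_of_nat_powr: "0 < n \<Longrightarrow> norm (of_nat n powr s :: complex) = real n powr Re s"
  using norm_powr_real_powr[of "complex_of_real (real n)" s] by simp

lemma nat_powr_has_derivative:
  assumes "0 < n"
  shows "((\<lambda>s. of_nat n powr s :: complex) has_field_derivative of_real (ln (real n)) * of_nat n powr s) (at s)"
  using has_field_derivative_powr_right[of "of_nat n" s] assms
    Ln_of_real[of "real n"] by simp

lemma holomorphic_nat_powr [holomorphic_intros]:
  assumes "0 < n" "f holomorphic_on A"
  shows "(\<lambda>s. of_nat n powr f s :: complex) holomorphic_on A"
  using assms by (intro holomorphic_on_powr_right) auto

text \<open>On the ball of radius \<open>Re s / 2\<close> around \<open>s\<close> the real part
  stays at least \<open>Re s / 2\<close>, so the terms have a summable majorant and the series may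
  be differentiated termwise.\<close>

lemma holomorphic_zeta_pole_free: "zeta_pole_free holomorphic_on {s. 0 < Re s}"
proof -
  have op: "open {s. 0 < Re s}" by (rule open_halfspace_Re_gt)
  have "\<exists>g g'. \<forall>s\<in>{s. 0 < Re s}. ((\<lambda>n. zeta_term n s) sums g s) \<and>
     ((\<lambda>n. deriv (zeta_term n) s) sums g' s) \<and> (g has_field_derivative g' s) (at s)"
  proof (rule series_and_derivative_comparison_local[OF op])
    fix n and s :: complex assume "s \<in> {s. 0 < Re s}"
    have "zeta_term n holomorphic_on UNIV"
      unfolding zeta_term_def by (intro holomorphic_intros) auto
    then show "(zeta_term n has_field_derivative deriv (zeta_term n) s) (at s)"
      using holomorphic_derivI by blast
  next
    fix s :: complex assume s: "s \<in> {s. 0 < Re s}"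
    define r where "r = Re s / 2"
    have r: "r > 0" using s by (simp add: r_def)
    have "norm (zeta_term n y) \<le> ((norm s + r + 1) * (norm s + r)) * real (Suc n) powr (- r - 1)"
      if "y \<in> ball s r" for y n
    proof -
      have "\<bar>Re s - Re y\<bar> \<le> norm (s - y)" using abs_Re_le_cmod[of "s - y"] by simp
      then have y: "Re y \<ge> r" using that by (auto simp: r_def dist_norm)
      have n1: "norm y \<le> norm s + r"
        using that norm_triangle_sub[of y s] by (auto simp: dist_norm norm_minus_commute)
      have n2: "norm (y - 1) \<le> norm s + r + 1"
        using n1 norm_triangle_ineq4[of y 1] by simp
      have "norm (zeta_term n y) \<le> norm (y - 1) * norm y * real (Suc n) powr (- Re y - 1)"
        using y r by (intro norm_zeta_term_le) auto
      also have "\<dots> \<le> ((norm s + r + 1) * (norm s + r)) * real (Suc n) powr (- r - 1)"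
        using y r n1 n2 by (intro mult_mono powr_mono) auto
      finally show ?thesis .
    qed
    moreover have "summable (\<lambda>n. ((norm s + r + 1) * (norm s + r)) * real (Suc n) powr (- r - 1))"
      using r by (intro summable_mult summable_Suc_powr) auto
    ultimately show "\<exists>d h. 0 < d \<and> summable h \<and> (\<forall>\<^sub>F n in sequentially. \<forall>y\<in>ball s d \<inter> {s. 0 < Re s}. norm (zeta_term n y) \<le> h n)"
      using r by (intro exI[of _ r] exI[of _ "\<lambda>n. ((norm s + r + 1) * (norm s + r)) * real (Suc n) powr (- r - 1)"]) auto
  qed
  then obtain g g' where g: "\<And>s. 0 < Re s \<Longrightarrow> (\<lambda>n. zeta_term n s) sums g s"
     "\<And>s. 0 < Re s \<Longrightarrow> (g has_field_derivative g' s) (at s)" by blast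
  have "(\<lambda>s. 1 + g s) holomorphic_on {s. 0 < Re s}"
    using g(2) op by (intro holomorphic_intros) (auto simp: holomorphic_on_open)
  moreover have "1 + g s = zeta_pole_free s" if "0 < Re s" for s
    using g(1)[OF that] by (simp add: zeta_pole_free_def sums_iff)
  ultimately show ?thesis by (rule holomorphic_transform) auto
qed

text \<open>All terms vanish at 1. The value says that zeta has residue 1 there.\<close>

lemma zeta_pole_free_1: "zeta_pole_free 1 = 1"
  by (simp add: zeta_pole_free_def zeta_term_def del: of_nat_Suc)

lemma summable_dirichlet_1:
  assumes "1 < Re s"
  shows "summable (\<lambda>n. norm (of_nat (Suc n) powr (-s) :: complex))"
proof -
  have "norm (of_nat (Suc n) powr (-s) :: complex) = real (Suc n) powr (- Re s)" for n
    by (subst norm_of_nat_powr) simp_all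
  then show ?thesis using summable_Suc_powr[of "- Re s"] assms by (simp only:)
qed

text \<open>For \<open>Re s > 1\<close> the two parts of each term can be summed separately, and the
  integral parts telescope to 1, cancelling the leading 1 of the definition.\<close>

lemma zeta_pole_free_eq:
  assumes "1 < Re s"
  shows "zeta_pole_free s = (s - 1) * (\<Sum>n. of_nat (Suc n) powr (-s))"
proof -
  have "(\<lambda>n. of_nat (Suc n) powr (-s) :: complex) sums (\<Sum>n. of_nat (Suc n) powr (-s))"
    by (rule summable_sums[OF summable_norm_cancel[OF summable_dirichlet_1[OF assms]]])
  then have 1: "(\<lambda>n. (s - 1) * of_nat (Suc n) powr (-s)) sums ((s - 1) * (\<Sum>n. of_nat (Suc n) powr (-s)))"
    by (rule sums_mult)
  have "(\<lambda>n. of_nat (Suc n) powr (1 - s) :: complex) \<longlonglongrightarrow> 0"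
  proof (rule tendsto_norm_zero_cancel)
    have "(\<lambda>n. real (Suc n) powr (1 - Re s)) \<longlonglongrightarrow> 0"
      using assms by (intro tendsto_neg_powr filterlim_compose[OF filterlim_real_sequentially filterlim_Suc]) auto
    moreover have "norm (of_nat (Suc n) powr (1 - s) :: complex) = real (Suc n) powr (1 - Re s)" for n
      by (subst norm_of_nat_powr) simp_all
    ultimately show "(\<lambda>n. norm (of_nat (Suc n) powr (1 - s) :: complex)) \<longlonglongrightarrow> 0"
      by (simp only:)
  qed
  then have "(\<lambda>n. of_nat (Suc n) powr (1 - s) - of_nat (Suc (Suc n)) powr (1 - s) :: complex) sums (of_nat (Suc 0) powr (1 - s) - 0)"
    by (rule telescope_sums'[where f = "\<lambda>n. of_nat (Suc n) powr (1 - s)"])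
  then have 2: "(\<lambda>n. of_nat (Suc n) powr (1 - s) - of_nat (Suc (Suc n)) powr (1 - s) :: complex) sums 1"
    by simp
  have "(\<lambda>n. zeta_term n s) sums ((s - 1) * (\<Sum>n. of_nat (Suc n) powr (-s)) - 1)"
    using sums_diff[OF 1 2] by (simp add: zeta_term_def algebra_simps del: of_nat_Suc)
  then show ?thesis by (simp add: zeta_pole_free_def sums_iff)
qed

section \<open>The Dirichlet series of the von Mangoldt function\<close>

lemma summable_dirichlet:
  fixes c :: "nat \<Rightarrow> complex"
  assumes "\<And>n. 1 \<le> n \<Longrightarrow> norm (c n) \<le> ln (real n)" and s: "1 < Re s"
  shows "summable (\<lambda>n. norm (c n * of_nat n powr (-s)))"
proof -
  define a where "a = (Re s - 1) / 2"
  have a: "a > 0" using s by (simp add: a_def)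
  have bd: "norm (c n * of_nat n powr (-s)) \<le> (1 / a) * real n powr (- 1 - a)" for n
  proof (cases "n = 0")
    case False
    then have "norm (c n * of_nat n powr (-s)) = norm (c n) * real n powr (- Re s)"
      by (simp add: norm_mult norm_of_nat_powr)
    also have "\<dots> \<le> (real n powr a / a) * real n powr (- Re s)"
      using False assms(1)[of n] ln_powr_bound[of "real n" a] a by (intro mult_right_mono) auto
    also have "\<dots> = (1 / a) * real n powr (a - Re s)"
      by (simp add: powr_add[symmetric])
    also have "a - Re s = - 1 - a" by (simp add: a_def field_simps)
    finally show ?thesis .
  qed auto
  show ?thesis
    by (rule summable_comparison_test'[where N = 0 and g = "\<lambda>n. (1 / a) * real n powr (- 1 - a)"])
       (use a bd in \<open>auto intro!: summable_mult simp: summable_real_powr_iff\<close>)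
qed

lemma norm_mangoldt_le_ln: "1 \<le> n \<Longrightarrow> norm (mangoldt n :: complex) \<le> ln (real n)"
  using mangoldt_le[of n] by (cases "n = 1") auto

lemma summable_zeta:
  assumes "1 < Re s"
  shows "summable (\<lambda>n. norm (of_nat n powr (-s) :: complex))"
  using summable_dirichlet_1[OF assms] summable_Suc_iff[of "\<lambda>n. norm (of_nat n powr (-s) :: complex)"]
  by simp

text \<open>Since \<open>0 powr z = 0\<close>, the series may start at \<open>n = 0\<close>, which
  lets it be multiplied with sums over all of \<open>nat\<close>.\<close>

lemma zeta_pole_free_eq':
  assumes "1 < Re s"
  shows "zeta_pole_free s = (s - 1) * (\<Sum>n. of_nat n powr (-s))"
proof -
  have "(\<Sum>n. of_nat (Suc n) powr (-s)) = (\<Sum>n. of_nat n powr (-s) :: complex)"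
    using suminf_split_head[OF summable_norm_cancel[OF summable_zeta[OF assms]]] by simp
  then show ?thesis using zeta_pole_free_eq[OF assms] by simp
qed

text \<open>Termwise differentiation; on a small ball the terms are dominated by those at the real
  point \<open>1 + r\<close>, halfway between 1 and \<open>Re s\<close>.\<close>

lemma zeta_has_derivative:
  assumes "1 < Re s"
  shows "((\<lambda>s. \<Sum>n. of_nat n powr (-s)) has_field_derivative
           - (\<Sum>n. of_real (ln (real n)) * of_nat n powr (-s))) (at s)"
proof -
  have op: "open {s. 1 < Re s}" by (rule open_halfspace_Re_gt)
  have "\<exists>g g'. \<forall>s\<in>{s. 1 < Re s}. ((\<lambda>n. of_nat n powr (-s)) sums g s) \<and>
     ((\<lambda>n. - (of_real (ln (real n)) * of_nat n powr (-s))) sums g' s) \<and> (g has_field_derivative g' s) (at s)"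
  proof (rule series_and_derivative_comparison_local[OF op])
    fix n and s :: complex
    show "((\<lambda>s. of_nat n powr (-s)) has_field_derivative - (of_real (ln (real n)) * of_nat n powr (-s))) (at s)"
    proof (cases "n = 0")
      case False
      then show ?thesis
        using DERIV_chain2[OF nat_powr_has_derivative DERIV_minus[OF DERIV_ident], of n s] by simp
    qed auto
  next
    fix s :: complex assume s: "s \<in> {s. 1 < Re s}"
    define r where "r = (Re s - 1) / 2"
    have r: "r > 0" using s by (simp add: r_def)
    have "norm (of_nat n powr (-y) :: complex) \<le> norm (of_nat n powr (- complex_of_real (1 + r)))"
      if "y \<in> ball s r" for y n
    proof (cases "n = 0")
      case False
      have "Re s - Re y \<le> norm (s - y)" using complex_Re_le_cmod[of "s - y"] by simp
      moreover have "norm (s - y) < r" using that by (simp add: dist_norm)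
      ultimately have "1 + r \<le> Re y" using r_def by (simp add: field_simps)
      then show ?thesis using False by (simp add: norm_of_nat_powr powr_mono)
    qed auto
    then show "\<exists>d h. 0 < d \<and> summable h \<and> (\<forall>\<^sub>F n in sequentially. \<forall>y\<in>ball s d \<inter> {s. 1 < Re s}. norm (of_nat n powr (-y) :: complex) \<le> h n)"
      using r summable_zeta[of "complex_of_real (1 + r)"]
      by (intro exI[of _ r] exI[of _ "\<lambda>n. norm (of_nat n powr (- complex_of_real (1 + r)))"]) auto
  qed
  then obtain g g' where g: "\<And>s. 1 < Re s \<Longrightarrow> (\<lambda>n. of_nat n powr (-s)) sums g s"
     "\<And>s. 1 < Re s \<Longrightarrow> (\<lambda>n. - (of_real (ln (real n)) * of_nat n powr (-s))) sums g' s"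
     "\<And>s. 1 < Re s \<Longrightarrow> (g has_field_derivative g' s) (at s)" by blast
  have "g' s = - (\<Sum>n. of_real (ln (real n)) * of_nat n powr (-s))"
    using sums_minus[OF g(2)[OF assms]] by (simp add: sums_iff minus_equation_iff)
  moreover have "((\<lambda>s. \<Sum>n. of_nat n powr (-s)) has_field_derivative g' s) (at s)"
    by (rule has_field_derivative_transform_within_open[OF g(3) op]) (use assms g(1) in \<open>auto simp: sums_iff\<close>)
  ultimately show ?thesis by simp
qed

text \<open>Absolute summability allows the double sum over \<open>(a, b)\<close> to be regrouped by
  the product \<open>n = a * b\<close>. The inner sum of \<open>mangoldt d\<close> over the divisors
  \<open>d\<close> of \<open>n\<close> is \<open>ln n\<close>.\<close>

lemma dirichlet_convolution_mangoldt:
  assumes "1 < Re s"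
  shows "(\<Sum>n. of_nat n powr (-s)) * (\<Sum>n. mangoldt n * of_nat n powr (-s))
           = (\<Sum>n. of_real (ln (real n)) * of_nat n powr (-s) :: complex)"
proof -
  let ?f = "\<lambda>n::nat. of_nat n powr (-s) :: complex"
  let ?g = "\<lambda>n. mangoldt n * ?f n"
  let ?l = "\<lambda>n::nat. of_real (ln (real n)) * ?f n"
  have sl: "summable (\<lambda>n. norm (?l n))"
    by (rule summable_dirichlet) (use assms in auto)
  have sg: "summable (\<lambda>n. norm (?g n))"
    by (rule summable_dirichlet[OF norm_mangoldt_le_ln assms])
  have hf: "(?f has_sum suminf ?f) UNIV"
    by (intro norm_summable_imp_has_sum summable_zeta assms summable_sums[OF summable_norm_cancel[OF summable_zeta[OF assms]]])
  have hg: "(?g has_sum suminf ?g) UNIV"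
    by (rule norm_summable_imp_has_sum[OF sg summable_sums[OF summable_norm_cancel[OF sg]]])
  have hl: "(?l has_sum suminf ?l) UNIV"
    by (rule norm_summable_imp_has_sum[OF sl summable_sums[OF summable_norm_cancel[OF sl]]])
  have af: "(\<lambda>n. norm (?f n)) summable_on UNIV" and ag: "(\<lambda>n. norm (?g n)) summable_on UNIV"
    using summable_nonneg_imp_summable_on[OF summable_zeta[OF assms]] summable_nonneg_imp_summable_on[OF sg]
    by auto
  have "(\<lambda>x. norm (case x of (a,b) \<Rightarrow> ?f a * ?g b)) summable_on UNIV \<times> UNIV"
    unfolding Infinite_Sum.abs_summable_on_Sigma_iff
  proof (intro conjI ballI)
    fix a
    show "(\<lambda>b. norm (case (a, b) of (a, b) \<Rightarrow> ?f a * ?g b)) summable_on UNIV"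
      using ag by (simp add: norm_mult summable_on_cmult_right)
    have "(\<Sum>\<^sub>\<infinity>b. norm (?f a * ?g b)) = norm (?f a) * (\<Sum>\<^sub>\<infinity>b. norm (?g b))" for a
      using ag by (simp only: norm_mult[of "?f a"] infsum_cmult_right)
    then show "(\<lambda>a. norm (\<Sum>\<^sub>\<infinity>b. norm (case (a, b) of (a, b) \<Rightarrow> ?f a * ?g b))) summable_on UNIV"
      using af by (simp add: norm_mult summable_on_cmult_left abs_mult)
  qed
  then have "(\<lambda>(a,b). ?f a * ?g b) summable_on UNIV \<times> UNIV"
    by (rule abs_summable_summable)
  then have P: "((\<lambda>(a,b). ?f a * ?g b) has_sum (suminf ?f * suminf ?g)) (UNIV \<times> UNIV)"
    by (intro has_sum_SigmaI[where g = "\<lambda>a. ?f a * suminf ?g"])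
       (auto intro!: has_sum_cmult_right hg has_sum_cmult_left hf)
  \<comment> \<open>Pairs with a zero coordinate contribute 0. They are dropped before regrouping
    because 0 has infinitely many divisors.\<close>
  have "((\<lambda>(a,b). ?f a * ?g b) has_sum (suminf ?f * suminf ?g)) ({1..} \<times> {1..})"
    by (rule has_sum_cong_neutral[THEN iffD1, OF _ _ _ P]) (auto simp: not_le)
  also have "?this \<longleftrightarrow> ((\<lambda>(n,d). mangoldt d * ?f n) has_sum (suminf ?f * suminf ?g)) (SIGMA n:{1..}. {d. d dvd n})"
    by (rule has_sum_reindex_bij_witness[where i = "\<lambda>(n,d). (n div d, d)" and j = "\<lambda>(a,b). (a*b, b)"])
       (auto simp: powr_times_real Suc_le_eq)
  finally have "((\<lambda>n. \<Sum>d | d dvd n. mangoldt d * ?f n) has_sum (suminf ?f * suminf ?g)) {1..}"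
    by (rule has_sum_SigmaD) (auto intro!: has_sum_finite)
  also have "?this \<longleftrightarrow> (?l has_sum (suminf ?f * suminf ?g)) UNIV"
    by (rule has_sum_cong_neutral) (auto simp: sum_distrib_right[symmetric] mangoldt_sum)
  finally show ?thesis using hl has_sum_unique by blast
qed

text \<open>The logarithmic derivative, written as a product so that it holds before
  \<open>zeta_pole_free\<close> is known not to vanish.\<close>

lemma deriv_zeta_pole_free:
  assumes "1 < Re s"
  shows "deriv zeta_pole_free s = zeta_pole_free s * (1 / (s - 1) - (\<Sum>n. mangoldt n * of_nat n powr (-s)))"
proof -
  let ?Z = "\<lambda>s. \<Sum>n. of_nat n powr (-s) :: complex"
  let ?L = "\<Sum>n. of_real (ln (real n)) * of_nat n powr (-s) :: complex"
  have op: "open {s. 1 < Re s}" by (rule open_halfspace_Re_gt)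
  have s: "s \<noteq> 1" using assms by auto
  have "((\<lambda>s. (s - 1) * ?Z s) has_field_derivative ?Z s - (s - 1) * ?L) (at s)"
    by (auto intro!: derivative_eq_intros zeta_has_derivative assms)
  then have "(zeta_pole_free has_field_derivative ?Z s - (s - 1) * ?L) (at s)"
    by (rule has_field_derivative_transform_within_open[OF _ op]) (use assms zeta_pole_free_eq' in auto)
  then have "deriv zeta_pole_free s = ?Z s - (s - 1) * ?L"
    by (rule DERIV_imp_deriv)
  moreover have "Z - (s - 1) * (Z * D) = (s - 1) * Z * (1 / (s - 1) - D)" for Z D
    using s by (simp add: right_diff_distrib)
  ultimately show ?thesis
    by (simp only: zeta_pole_free_eq'[OF assms] dirichlet_convolution_mangoldt[OF assms, symmetric])
qed

definition mangoldt_series :: "complex \<Rightarrow> complex" where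
  "mangoldt_series s = (\<Sum>n. mangoldt n * of_nat n powr (-s))"

lemma mangoldt_series_sums:
  assumes "1 < Re s"
  shows "(\<lambda>n. mangoldt n * of_nat n powr (-s)) sums mangoldt_series s"
  unfolding mangoldt_series_def
  by (rule summable_sums[OF summable_norm_cancel[OF summable_dirichlet[OF norm_mangoldt_le_ln assms]]])

text \<open>Separating the nonnegative modulus from the phase turns real parts of the series into
  cosine sums with nonnegative coefficients.\<close>

lemma mangoldt_term_polar:
  "mangoldt n * of_nat n powr (- (of_real \<sigma> + \<i> * of_real t))
     = of_real (mangoldt n * real n powr (- \<sigma>)) * cis (- (t * ln (real n)))"
proof (cases "n = 0")
  case False
  then have "(of_nat n :: complex) powr (- (of_real \<sigma> + \<i> * of_real t))
      = exp (of_real (- \<sigma> * ln (real n)) + \<i> * of_real (- (t * ln (real n))))"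
    using Ln_of_real[of "real n"] by (simp add: powr_def algebra_simps)
  also have "\<dots> = of_real (real n powr (- \<sigma>)) * cis (- (t * ln (real n)))"
    using False by (simp only: exp_add exp_of_real cis_conv_exp[symmetric]) (simp add: powr_def)
  finally show ?thesis by simp
qed auto

lemma mangoldt_series_bound:
  assumes "1 < Re s" "Re s \<le> Re s'"
  shows "norm (mangoldt_series s') \<le> (\<Sum>n. norm (mangoldt n * of_nat n powr (-s) :: complex))"
proof -
  have "norm (mangoldt_series s') \<le> (\<Sum>n. norm (mangoldt n * of_nat n powr (-s') :: complex))"
    unfolding mangoldt_series_def using assms
    by (intro summable_norm summable_dirichlet norm_mangoldt_le_ln) auto
  also have "\<dots> \<le> (\<Sum>n. norm (mangoldt n * of_nat n powr (-s) :: complex))"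
  proof (rule suminf_le)
    fix n show "norm (mangoldt n * of_nat n powr (-s') :: complex) \<le> norm (mangoldt n * of_nat n powr (-s) :: complex)"
    proof (cases "n = 0")
      case False
      then show ?thesis using assms
        by (auto simp: norm_mult norm_of_nat_powr mangoldt_nonneg intro!: mult_left_mono powr_mono)
    qed auto
  qed (use assms in \<open>auto intro!: summable_dirichlet norm_mangoldt_le_ln\<close>)
  finally show ?thesis .
qed

section \<open>Orders of zeros and non-vanishing for \<open>Re s >= 1\<close>\<close>

text \<open>Here \<open>m\<close> is the order of the zero: if
  \<open>f w = (w - \<xi>) ^ m * g w\<close> with \<open>g\<close> free of zeros, then
  \<open>f' / f\<close> is \<open>m / (w - \<xi>)\<close> plus a function continuous at
  \<open>\<xi>\<close>.\<close>

lemma log_deriv_residue: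
  fixes f :: "complex \<Rightarrow> complex"
  assumes f: "f holomorphic_on S" "open S" "connected S" "\<xi> \<in> S" and nc: "\<not> f constant_on S"
  obtains m :: nat where "((\<lambda>w. (w - \<xi>) * (deriv f w / f w)) \<longlongrightarrow> of_nat m) (at \<xi>)"
    "eventually (\<lambda>w. f w \<noteq> 0) (at \<xi>)" "f \<xi> = 0 \<longleftrightarrow> 0 < m"
proof (cases "f \<xi> = 0")
  case False
  have "deriv f holomorphic_on S" using f by (intro holomorphic_deriv)
  then have c: "isCont (deriv f) \<xi>" "isCont f \<xi>"
    using f by (auto dest!: holomorphic_on_imp_continuous_on simp: continuous_on_eq_continuous_at)
  then have "((\<lambda>w. (w - \<xi>) * (deriv f w / f w)) \<longlongrightarrow> (\<xi> - \<xi>) * (deriv f \<xi> / f \<xi>)) (at \<xi>)"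
    using False unfolding isCont_def by (intro tendsto_intros) auto
  moreover have "eventually (\<lambda>w. f w \<noteq> 0) (at \<xi>)"
    using c(2) False unfolding isCont_def by (rule tendsto_imp_eventually_ne)
  ultimately show ?thesis using False that[of 0] by simp
next
  case True
  obtain g r n where n: "0 < n" and r: "0 < r" "ball \<xi> r \<subseteq> S" and g: "g holomorphic_on ball \<xi> r"
    and fg: "\<And>w. w \<in> ball \<xi> r \<Longrightarrow> f w = (w - \<xi>) ^ n * g w"
    and g0: "\<And>w. w \<in> ball \<xi> r \<Longrightarrow> g w \<noteq> 0"
    using holomorphic_factor_zero_nonconstant[OF f(1-4) True nc] by metis
  have ev: "eventually (\<lambda>w. w \<in> ball \<xi> r - {\<xi>}) (at \<xi>)"
    using r by (intro eventually_at_in_open) auto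
  have eq: "(w - \<xi>) * (deriv f w / f w) = of_nat n + (w - \<xi>) * (deriv g w / g w)"
    if w: "w \<in> ball \<xi> r - {\<xi>}" for w
  proof -
    have "((\<lambda>w. (w - \<xi>) ^ n * g w) has_field_derivative
        of_nat n * (w - \<xi>) ^ (n - 1) * g w + (w - \<xi>) ^ n * deriv g w) (at w)"
      using w by (auto intro!: derivative_eq_intros holomorphic_derivI[OF g])
    then have "(f has_field_derivative
        of_nat n * (w - \<xi>) ^ (n - 1) * g w + (w - \<xi>) ^ n * deriv g w) (at w)"
      by (rule has_field_derivative_transform_within_open[where S = "ball \<xi> r"]) (use w fg in auto)
    then have d: "deriv f w = of_nat n * (w - \<xi>) ^ (n - 1) * g w + (w - \<xi>) ^ n * deriv g w"
      by (rule DERIV_imp_deriv)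
    have "(w - \<xi>) ^ n = (w - \<xi>) * (w - \<xi>) ^ (n - 1)" using n by (cases n) auto
    moreover have "x * (c * P * G + (x * P) * G') = c * (x * P * G) + x * (G' / G) * (x * P * G)"
      if "G \<noteq> 0" for x c P G G' :: complex
      using that by (simp add: algebra_simps)
    ultimately have "(w - \<xi>) * deriv f w = of_nat n * f w + (w - \<xi>) * (deriv g w / g w) * f w"
      using w fg[of w] g0[of w] by (simp only: d) auto
    moreover have "f w \<noteq> 0" using w fg[of w] g0[of w] by auto
    ultimately show ?thesis by (simp add: field_simps)
  qed
  have "deriv g holomorphic_on ball \<xi> r" using g by (intro holomorphic_deriv) auto
  then have c: "isCont (deriv g) \<xi>" "isCont g \<xi>"
    using g r by (auto dest!: holomorphic_on_imp_continuous_on simp: continuous_on_eq_continuous_at)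
  then have "((\<lambda>w. of_nat n + (w - \<xi>) * (deriv g w / g w)) \<longlongrightarrow> of_nat n + (\<xi> - \<xi>) * (deriv g \<xi> / g \<xi>)) (at \<xi>)"
    using g0[of \<xi>] r unfolding isCont_def by (intro tendsto_intros) auto
  then have "((\<lambda>w. of_nat n + (w - \<xi>) * (deriv g w / g w)) \<longlongrightarrow> of_nat n) (at \<xi>)"
    by simp
  then have "((\<lambda>w. (w - \<xi>) * (deriv f w / f w)) \<longlongrightarrow> of_nat n) (at \<xi>)"
    by (rule Lim_transform_eventually[OF _ eventually_mono[OF ev eq[symmetric]]])
  moreover have "eventually (\<lambda>w. f w \<noteq> 0) (at \<xi>)"
    using ev by eventually_elim (use fg g0 in auto)
  ultimately show ?thesis using True n that by blast
qed

text \<open>The order of the zero at \<open>\<xi>\<close> is read off along the horizontal ray to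
  the right of \<open>\<xi>\<close>, where the Dirichlet series converges.\<close>

lemma zeta_pole_free_order:
  assumes "1 \<le> Re \<xi>"
  obtains m :: nat where "((\<lambda>\<delta>. of_real \<delta> * (1 / (\<xi> + of_real \<delta> - 1) - mangoldt_series (\<xi> + of_real \<delta>))) \<longlongrightarrow> of_nat m) (at_right 0)"
    "zeta_pole_free \<xi> = 0 \<longleftrightarrow> 0 < m"
proof (cases "zeta_pole_free constant_on {s. 0 < Re s}")
  \<comment> \<open>The residue lemma concerns non-constant functions. A constant
    \<open>zeta_pole_free\<close> would equal 1 and have zero logarithmic derivative, so
    \<open>m = 0\<close> works.\<close>
  case True
  then obtain c where c: "\<And>s. 0 < Re s \<Longrightarrow> zeta_pole_free s = c" by (auto simp: constant_on_def)
  have c1: "c = 1" using c[of 1] zeta_pole_free_1 by simp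
  have "1 / (s - 1) - mangoldt_series s = 0" if "1 < Re s" for s
  proof -
    have "(zeta_pole_free has_field_derivative 0) (at s)"
      by (rule has_field_derivative_transform_within_open[of "\<lambda>_. c" _ _ "{s. 0 < Re s}"])
         (use that c in \<open>auto simp: open_halfspace_Re_gt\<close>)
    then have "deriv zeta_pole_free s = 0" by (rule DERIV_imp_deriv)
    then show ?thesis
      using deriv_zeta_pole_free[OF that] c[of s] c1 that by (simp add: mangoldt_series_def)
  qed
  then have "eventually (\<lambda>\<delta>. 0 = of_real \<delta> * (1 / (\<xi> + of_real \<delta> - 1) - mangoldt_series (\<xi> + of_real \<delta>))) (at_right (0::real))"
    using assms by (intro eventually_at_rightI[of 0 1]) auto
  from Lim_transform_eventually[OF tendsto_const this]
  show ?thesis using c[of \<xi>] c1 assms by (intro that[of 0]) auto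
next
  case False
  obtain m :: nat where m: "((\<lambda>w. (w - \<xi>) * (deriv zeta_pole_free w / zeta_pole_free w)) \<longlongrightarrow> of_nat m) (at \<xi>)"
    "eventually (\<lambda>w. zeta_pole_free w \<noteq> 0) (at \<xi>)" "zeta_pole_free \<xi> = 0 \<longleftrightarrow> 0 < m"
    using log_deriv_residue[OF holomorphic_zeta_pole_free open_halfspace_Re_gt convex_connected[OF convex_halfspace_Re_gt] _ False, of \<xi>] assms
    by auto
  have F: "filterlim (\<lambda>\<delta>. \<xi> + of_real \<delta>) (at \<xi>) (at_right (0::real))"
  proof (rule filterlim_atI)
    show "((\<lambda>\<delta>. \<xi> + of_real \<delta>) \<longlongrightarrow> \<xi>) (at_right (0::real))"
      by (auto intro!: tendsto_eq_intros)
    show "\<forall>\<^sub>F \<delta> in at_right (0::real). \<xi> + of_real \<delta> \<noteq> \<xi>"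
      by (intro eventually_at_rightI[of 0 1]) auto
  qed
  have "\<forall>\<^sub>F \<delta> in at_right (0::real). \<delta> > 0" by (intro eventually_at_rightI[of 0 1]) auto
  then have "\<forall>\<^sub>F \<delta> in at_right (0::real). (\<xi> + of_real \<delta> - \<xi>) * (deriv zeta_pole_free (\<xi> + of_real \<delta>) / zeta_pole_free (\<xi> + of_real \<delta>))
     = of_real \<delta> * (1 / (\<xi> + of_real \<delta> - 1) - mangoldt_series (\<xi> + of_real \<delta>))"
    using filterlim_iff[THEN iffD1, OF F, rule_format, OF m(2)]
  proof eventually_elim
    case (elim \<delta>)
    then show ?case using assms deriv_zeta_pole_free[of "\<xi> + of_real \<delta>"]
      by (simp add: mangoldt_series_def)
  qed
  then have "((\<lambda>\<delta>. of_real \<delta> * (1 / (\<xi> + of_real \<delta> - 1) - mangoldt_series (\<xi> + of_real \<delta>))) \<longlongrightarrow> of_nat m) (at_right 0)"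
    by (rule Lim_transform_eventually[OF filterlim_compose[OF m(1) F]])
  from that[OF this m(3)] show ?thesis .
qed

text \<open>Away from 1 the pole term, multiplied by \<open>\<delta>\<close>, tends to 0.\<close>

lemma mangoldt_series_residue:
  assumes "1 \<le> Re \<xi>" "\<xi> \<noteq> 1"
  obtains m :: nat where "((\<lambda>\<delta>. of_real \<delta> * mangoldt_series (\<xi> + of_real \<delta>)) \<longlongrightarrow> - of_nat m) (at_right 0)"
    "zeta_pole_free \<xi> = 0 \<longleftrightarrow> 0 < m"
proof -
  obtain m :: nat where m: "((\<lambda>\<delta>. of_real \<delta> * (1 / (\<xi> + of_real \<delta> - 1) - mangoldt_series (\<xi> + of_real \<delta>))) \<longlongrightarrow> of_nat m) (at_right 0)"
    "zeta_pole_free \<xi> = 0 \<longleftrightarrow> 0 < m"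
    using zeta_pole_free_order[OF assms(1)] .
  have "((\<lambda>\<delta>. of_real \<delta> * (1 / (\<xi> + of_real \<delta> - 1))) \<longlongrightarrow> of_real 0 * (1 / (\<xi> + of_real 0 - 1))) (at_right (0::real))"
    using assms by (intro tendsto_intros) auto
  from tendsto_diff[OF this m(1)] show ?thesis
    using m(2) by (intro that[of m]) (auto simp: algebra_simps)
qed

text \<open>The Mangoldt series stays bounded to the right of \<open>\<xi>\<close>, so it has
  residue 0 and the order of the zero is 0.\<close>

lemma zeta_pole_free_nonzero_gt:
  assumes "1 < Re \<xi>"
  shows "zeta_pole_free \<xi> \<noteq> 0"
proof -
  have "\<xi> \<noteq> 1" using assms by auto
  then obtain m :: nat where m: "((\<lambda>\<delta>. of_real \<delta> * mangoldt_series (\<xi> + of_real \<delta>)) \<longlongrightarrow> - of_nat m) (at_right 0)"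
    "zeta_pole_free \<xi> = 0 \<longleftrightarrow> 0 < m"
    using mangoldt_series_residue[of \<xi>] assms by auto
  define C where "C = (\<Sum>n. norm (mangoldt n * of_nat n powr (-\<xi>) :: complex))"
  have "((\<lambda>\<delta>. of_real \<delta> * mangoldt_series (\<xi> + of_real \<delta>)) \<longlongrightarrow> 0) (at_right (0::real))"
  proof (rule Lim_null_comparison)
    show "\<forall>\<^sub>F \<delta> in at_right (0::real). norm (of_real \<delta> * mangoldt_series (\<xi> + of_real \<delta>)) \<le> \<delta> * C"
      using mangoldt_series_bound[OF assms, of "\<xi> + of_real _"]
      by (intro eventually_at_rightI[of 0 1]) (auto simp: norm_mult C_def intro!: mult_left_mono)
    show "((\<lambda>\<delta>. \<delta> * C) \<longlongrightarrow> 0) (at_right 0)"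
      by (auto intro!: tendsto_eq_intros)
  qed
  with m(1) have "- of_nat m = (0::complex)" by (rule tendsto_unique[rotated]) simp
  then show ?thesis using m(2) by simp
qed

text \<open>Termwise from \<open>3 + 4 * cos v + cos (2 * v) = 2 * (1 + cos v)^2\<close>.\<close>

lemma mangoldt_series_341:
  assumes "1 < \<sigma>"
  shows "0 \<le> Re (3 * mangoldt_series (of_real \<sigma>) + 4 * mangoldt_series (of_real \<sigma> + \<i> * of_real t)
             + mangoldt_series (of_real \<sigma> + \<i> * of_real (2 * t)))"
proof -
  have S: "(\<lambda>n. mangoldt n * real n powr (-\<sigma>) * cos (u * ln (real n))) sums Re (mangoldt_series (of_real \<sigma> + \<i> * of_real u))" for u
    using sums_Re[OF mangoldt_series_sums[of "of_real \<sigma> + \<i> * of_real u"]] assms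
    by (simp only: mangoldt_term_polar) simp
  have 1: "(\<lambda>n. 3 * (mangoldt n * real n powr (-\<sigma>) * cos (0 * ln (real n)))
      + 4 * (mangoldt n * real n powr (-\<sigma>) * cos (t * ln (real n)))
      + mangoldt n * real n powr (-\<sigma>) * cos ((2 * t) * ln (real n)))
     sums (3 * Re (mangoldt_series (of_real \<sigma> + \<i> * of_real 0)) + 4 * Re (mangoldt_series (of_real \<sigma> + \<i> * of_real t))
       + Re (mangoldt_series (of_real \<sigma> + \<i> * of_real (2 * t))))"
    by (intro sums_add sums_mult S)
  have 2: "0 \<le> 3 * (mangoldt n * real n powr (-\<sigma>) * cos (0 * ln (real n)))
      + 4 * (mangoldt n * real n powr (-\<sigma>) * cos (t * ln (real n)))
      + mangoldt n * real n powr (-\<sigma>) * cos ((2 * t) * ln (real n))" for n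
  proof -
    define c w where "c = cos (t * ln (real n))" and "w = mangoldt n * real n powr (-\<sigma>)"
    have "cos ((2 * t) * ln (real n)) = 2 * c\<^sup>2 - 1"
      using cos_double_cos[of "t * ln (real n)"] by (simp add: c_def mult.assoc)
    then have "3 * (w * cos (0 * ln (real n))) + 4 * (w * cos (t * ln (real n))) + w * cos ((2 * t) * ln (real n))
        = w * (2 * (1 + c)\<^sup>2)"
      by (simp only: c_def[symmetric]) (simp add: power2_eq_square algebra_simps)
    then show ?thesis by (simp add: mangoldt_nonneg w_def)
  qed
  show ?thesis using sums_le[OF 2 sums_zero 1] by simp
qed

text \<open>Multiplying the 3-4-1 inequality by \<open>\<delta>\<close> and letting
  \<open>\<delta>\<close> tend to 0 gives \<open>0 <= 3 - 4 * m - m'\<close> for the orders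
  \<open>m\<close>, \<open>m'\<close> of the zeros at \<open>1 + i t\<close> and
  \<open>1 + 2 i t\<close>, hence \<open>m = 0\<close>.\<close>

lemma zeta_pole_free_nonzero:
  assumes "1 \<le> Re \<xi>"
  shows "zeta_pole_free \<xi> \<noteq> 0"
proof (cases "1 < Re \<xi> \<or> \<xi> = 1")
  case True
  then show ?thesis using zeta_pole_free_nonzero_gt zeta_pole_free_1 by auto
next
  case False
  define t where "t = Im \<xi>"
  have \<xi>: "\<xi> = 1 + \<i> * of_real t" using False assms by (simp add: complex_eq_iff t_def)
  have t: "t \<noteq> 0" using False \<xi> by auto
  obtain m :: nat where m: "((\<lambda>\<delta>. of_real \<delta> * mangoldt_series (1 + \<i> * of_real t + of_real \<delta>)) \<longlongrightarrow> - of_nat m) (at_right 0)"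
    "zeta_pole_free \<xi> = 0 \<longleftrightarrow> 0 < m"
    using mangoldt_series_residue[of "1 + \<i> * of_real t"] t \<xi> by (auto simp: complex_eq_iff)
  obtain m' :: nat where m': "((\<lambda>\<delta>. of_real \<delta> * mangoldt_series (1 + \<i> * of_real (2 * t) + of_real \<delta>)) \<longlongrightarrow> - of_nat m') (at_right 0)"
    using mangoldt_series_residue[of "1 + \<i> * of_real (2 * t)"] t by (auto simp: complex_eq_iff)
  obtain m0 :: nat where m0: "((\<lambda>\<delta>. of_real \<delta> * (1 / (1 + of_real \<delta> - 1) - mangoldt_series (1 + of_real \<delta>))) \<longlongrightarrow> of_nat m0) (at_right 0)"
      "zeta_pole_free 1 = 0 \<longleftrightarrow> 0 < m0"
    using zeta_pole_free_order[of 1] by auto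
  have "\<forall>\<^sub>F \<delta> in at_right (0::real). 1 - of_real \<delta> * (1 / (1 + of_real \<delta> - 1) - mangoldt_series (1 + of_real \<delta>)) = of_real \<delta> * mangoldt_series (1 + of_real \<delta>)"
    by (intro eventually_at_rightI[of 0 1]) (auto simp: right_diff_distrib)
  from Lim_transform_eventually[OF tendsto_diff[OF tendsto_const m0(1)] this]
  have d: "((\<lambda>\<delta>. of_real \<delta> * mangoldt_series (1 + of_real \<delta>)) \<longlongrightarrow> 1) (at_right (0::real))"
    using m0(2) zeta_pole_free_1 by simp
  have "((\<lambda>\<delta>. Re (3 * (of_real \<delta> * mangoldt_series (1 + of_real \<delta>))
      + 4 * (of_real \<delta> * mangoldt_series (1 + \<i> * of_real t + of_real \<delta>))
      + of_real \<delta> * mangoldt_series (1 + \<i> * of_real (2 * t) + of_real \<delta>))) \<longlongrightarrow> Re (3 * 1 + 4 * - of_nat m + - of_nat m')) (at_right (0::real))"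
    by (intro tendsto_intros d m m')
  moreover have "\<forall>\<^sub>F \<delta> in at_right (0::real). 0 \<le> Re (3 * (of_real \<delta> * mangoldt_series (1 + of_real \<delta>))
      + 4 * (of_real \<delta> * mangoldt_series (1 + \<i> * of_real t + of_real \<delta>))
      + of_real \<delta> * mangoldt_series (1 + \<i> * of_real (2 * t) + of_real \<delta>))"
  proof (rule eventually_at_rightI[of 0 1])
    fix \<delta> :: real assume "\<delta> \<in> {0<..<1}"
    then have "0 \<le> \<delta> * Re (3 * mangoldt_series (of_real (1 + \<delta>)) + 4 * mangoldt_series (of_real (1 + \<delta>) + \<i> * of_real t)
             + mangoldt_series (of_real (1 + \<delta>) + \<i> * of_real (2 * t)))"
      by (intro mult_nonneg_nonneg mangoldt_series_341) auto
    then show "0 \<le> Re (3 * (of_real \<delta> * mangoldt_series (1 + of_real \<delta>))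
      + 4 * (of_real \<delta> * mangoldt_series (1 + \<i> * of_real t + of_real \<delta>))
      + of_real \<delta> * mangoldt_series (1 + \<i> * of_real (2 * t) + of_real \<delta>))"
      by (simp add: algebra_simps)
  qed simp
  ultimately have "0 \<le> Re (3 * 1 + 4 * - of_nat m + - of_nat m')"
    by (intro tendsto_lowerbound[where F = "at_right (0::real)"]) auto
  then have "real (4 * m + m') \<le> real 3" by simp
  then have "m = 0" by (simp only: of_nat_le_iff)
  then show ?thesis using m(2) by simp
qed

section \<open>Prime powers in short intervals\<close>

text \<open>Uniform approximation by a polynomial \<open>g\<close>, for which integration by parts
  gives a bound \<open>C / L\<close>.\<close>

lemma Riemann_Lebesgue_unit_interval:
  fixes f :: "real \<Rightarrow> complex"
  assumes f: "continuous_on {0..1} f"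
  shows "((\<lambda>L. integral {0..1} (\<lambda>t. f t * cis (L * t))) \<longlongrightarrow> 0) at_top"
proof (rule tendstoI)
  fix e :: real assume e: "0 < e"
  obtain g where g: "polynomial_function g" "\<And>t. t \<in> {0..1} \<Longrightarrow> norm (f t - g t) < e / 2"
    using Stone_Weierstrass_polynomial_function[OF _ f, of "e / 2"] e by auto
  obtain g' where g': "polynomial_function g'" "\<And>t. (g has_vector_derivative g' t) (at t)"
    using has_vector_derivative_polynomial_function[OF g(1)] by auto
  have cg: "continuous_on {0..1} g" "continuous_on {0..1} g'"
    using g(1) g'(1) by (auto intro: continuous_on_polymonial_function)
  have ccis: "continuous_on {0..1} (\<lambda>t. cis (L * t))" for L :: real
    by (intro continuous_intros)
  define C where "C = norm (g 1) + norm (g 0) + integral {0..1} (\<lambda>t. norm (g' t))"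
  have *: "norm (integral {0..1} (\<lambda>t. g t * cis (L * t))) \<le> C / L" if L: "L > 0" for L
  proof -
    have 1: "((\<lambda>t. g t * cis (L * t) + g' t * cis (L * t) / (\<i> * of_real L)) has_integral
       g 1 * cis (L * 1) / (\<i> * of_real L) - g 0 * cis (L * 0) / (\<i> * of_real L)) {0..1}"
    proof (rule fundamental_theorem_of_calculus)
      fix t :: real
      have "((\<lambda>t. cis (L * t)) has_vector_derivative (\<i> * of_real L) * cis (L * t)) (at t within {0..1})"
        using exp_scaleR_has_vector_derivative_right[of "\<i> * of_real L" t "{0..1}"]
        by (simp add: cis_conv_exp scaleR_conv_of_real mult_ac)
      then show "((\<lambda>t. g t * cis (L * t) / (\<i> * of_real L)) has_vector_derivative
          g t * cis (L * t) + g' t * cis (L * t) / (\<i> * of_real L)) (at t within {0..1})"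
        using L by (auto intro!: derivative_eq_intros has_vector_derivative_at_within[OF g'(2)] simp: field_simps)
    qed simp
    have 2: "((\<lambda>t. g' t * cis (L * t) / (\<i> * of_real L)) has_integral integral {0..1} (\<lambda>t. g' t * cis (L * t) / (\<i> * of_real L))) {0..1}"
      using L by (intro integrable_integral integrable_continuous_real continuous_intros cg ccis) auto
    have "((\<lambda>t. g t * cis (L * t)) has_integral
       g 1 * cis (L * 1) / (\<i> * of_real L) - g 0 * cis (L * 0) / (\<i> * of_real L)
       - integral {0..1} (\<lambda>t. g' t * cis (L * t) / (\<i> * of_real L))) {0..1}"
      using has_integral_diff[OF 1 2] by simp
    then have "integral {0..1} (\<lambda>t. g t * cis (L * t)) = g 1 * cis (L * 1) / (\<i> * of_real L) - g 0 * cis (L * 0) / (\<i> * of_real L)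
       - integral {0..1} (\<lambda>t. g' t * cis (L * t) / (\<i> * of_real L))"
      by (rule integral_unique)
    also have "norm \<dots> \<le> norm (g 1 * cis (L * 1) / (\<i> * of_real L)) + norm (g 0 * cis (L * 0) / (\<i> * of_real L))
        + norm (integral {0..1} (\<lambda>t. g' t * cis (L * t) / (\<i> * of_real L)))"
      by (intro order_trans[OF norm_triangle_ineq4] add_mono norm_triangle_ineq4 order_refl)
    also have "norm (integral {0..1} (\<lambda>t. g' t * cis (L * t) / (\<i> * of_real L))) \<le> integral {0..1} (\<lambda>t. norm (g' t) / L)"
      using L by (intro integral_norm_bound_integral integrable_continuous_real continuous_intros cg ccis)
         (auto simp: norm_mult norm_divide)
    also have "integral {0..1} (\<lambda>t. norm (g' t) / L) = integral {0..1} (\<lambda>t. norm (g' t)) / L"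
      by (rule integral_divide)
    finally show ?thesis using L by (simp add: C_def norm_mult norm_divide add_divide_distrib)
  qed
  have "((\<lambda>L. C / L) \<longlongrightarrow> 0) at_top"
    by (rule tendsto_divide_0[OF tendsto_const filterlim_mono[OF filterlim_ident at_top_le_at_infinity order_refl]])
  then have "\<forall>\<^sub>F L in at_top. \<bar>C / L\<bar> < e / 2"
    using e by (auto dest!: tendstoD[where e = "e/2"] simp: dist_real_def)
  then show "\<forall>\<^sub>F L in at_top. dist (integral {0..1} (\<lambda>t. f t * cis (L * t))) 0 < e"
    using eventually_gt_at_top[of 0]
  proof eventually_elim
    case (elim L)
    have "integral {0..1} (\<lambda>t. f t * cis (L * t)) = integral {0..1} (\<lambda>t. (f t - g t) * cis (L * t)) + integral {0..1} (\<lambda>t. g t * cis (L * t))"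
      by (subst integral_add[symmetric])
         (auto intro!: integrable_continuous_real continuous_intros cg f ccis simp: algebra_simps)
    also have "norm \<dots> \<le> norm (integral {0..1} (\<lambda>t. (f t - g t) * cis (L * t))) + norm (integral {0..1} (\<lambda>t. g t * cis (L * t)))"
      by (rule norm_triangle_ineq)
    also have "norm (integral {0..1} (\<lambda>t. (f t - g t) * cis (L * t))) \<le> integral {0..1} (\<lambda>t::real. e / 2)"
      by (intro integral_norm_bound_integral integrable_continuous_real continuous_intros cg f ccis)
         (use g(2) in \<open>auto simp: norm_mult intro: less_imp_le\<close>)
    also have "integral {0..1} (\<lambda>t::real. e / 2) = e / 2" by simp
    also have "norm (integral {0..1} (\<lambda>t. g t * cis (L * t))) < e / 2"
      using *[of L] elim by linarith
    finally show ?case by simp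
  qed
qed

text \<open>The cosine transform of this weight is half of Selberg's function
  \<open>(sin (\<pi> u) / (\<pi> u))\<^sup>2 / (1 - u\<^sup>2)\<close>.\<close>

definition selberg_weight :: "real \<Rightarrow> real" where
  "selberg_weight t = 1 - t + sin (2 * pi * t) / (2 * pi)"

lemma continuous_on_selberg_weight [continuous_intros]:
  fixes f :: "real \<Rightarrow> real"
  shows "continuous_on A f \<Longrightarrow> continuous_on A (\<lambda>x. selberg_weight (f x))"
  unfolding selberg_weight_def by (auto intro!: continuous_intros continuous_on_sin)

text \<open>The weight has derivative \<open>cos (2 * pi * t) - 1 <= 0\<close> and vanishes at
  \<open>t = 1\<close>.\<close>

lemma selberg_weight_nonneg:
  assumes "t \<in> {0..1}"
  shows "0 \<le> selberg_weight t"
proof -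
  have "selberg_weight 1 \<le> selberg_weight t"
  proof (rule DERIV_nonpos_imp_nonincreasing[of t 1])
    fix x :: real
    have "(selberg_weight has_real_derivative - 1 + cos (2 * pi * x)) (at x)"
      unfolding selberg_weight_def by (auto intro!: derivative_eq_intros)
    then show "\<exists>y. (selberg_weight has_real_derivative y) (at x) \<and> y \<le> 0" by force
  qed (use assms in auto)
  then show ?thesis by (simp add: selberg_weight_def)
qed

lemma selberg_weight_le:
  assumes "t \<in> {0..1}"
  shows "selberg_weight t \<le> 2"
proof -
  have "sin (2 * pi * t) / (2 * pi) \<le> 1 / (2 * pi)"
    by (intro divide_right_mono) auto
  also have "\<dots> \<le> 1" using pi_gt3 by simp
  finally show ?thesis using assms unfolding selberg_weight_def atLeastAtMost_iff by linarith
qed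

lemma selberg_weight_cos_integral:
  assumes "1 < \<bar>u\<bar>"
  shows "((\<lambda>t. selberg_weight t * cos (2 * pi * u * t)) has_integral
           (1 - cos (2 * pi * u)) / ((2 * pi)\<^sup>2 * u\<^sup>2 * (1 - u\<^sup>2))) {0..1}"
proof -
  define a where "a = 2 * pi"
  have a: "a \<noteq> 0" by (simp add: a_def)
  have u: "u \<noteq> 0" "1 + u \<noteq> 0" "1 - u \<noteq> 0" using assms by auto
  \<comment> \<open>The first two summands integrate \<open>(1 - t) * cos (a * u * t)\<close> by
    parts; the last one integrates \<open>sin (a * t) * cos (a * u * t)\<close> after splitting the
    product into a sum of sines.\<close>
  let ?F = "\<lambda>t. (1 - t) * sin (a * u * t) / (a * u) - cos (a * u * t) / (a * u)\<^sup>2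
     + (- cos (a * (1 + u) * t) / (a * (1 + u)) - cos (a * (1 - u) * t) / (a * (1 - u))) / (2 * a)"
  have "((\<lambda>t. selberg_weight t * cos (2 * pi * u * t)) has_integral (?F 1 - ?F 0)) {0..1}"
  proof (rule fundamental_theorem_of_calculus)
    fix t :: real
    have "(?F has_real_derivative (1 - t) * cos (a * u * t) + (sin (a * (1 + u) * t) + sin (a * (1 - u) * t)) / (2 * a)) (at t within {0..1})"
      using a u by (auto intro!: derivative_eq_intros simp: divide_simps power2_eq_square) (simp add: algebra_simps)
    moreover have "a * (1 + u) * t = a * t + a * u * t" "a * (1 - u) * t = a * t - a * u * t"
      by (simp_all add: algebra_simps)
    moreover have "(1 - t) * cos (a * u * t) + (sin (a * t + a * u * t) + sin (a * t - a * u * t)) / (2 * a)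
       = selberg_weight t * cos (2 * pi * u * t)"
      unfolding a_def by (simp add: sin_add sin_diff selberg_weight_def field_simps)
    ultimately show "(?F has_vector_derivative selberg_weight t * cos (2 * pi * u * t)) (at t within {0..1})"
      by (simp only: has_real_derivative_iff_has_vector_derivative)
  qed simp
  moreover have "?F 1 - ?F 0 = (1 - cos (2 * pi * u)) / ((2 * pi)\<^sup>2 * u\<^sup>2 * (1 - u\<^sup>2))"
  proof -
    have c: "cos (a * (1 + u)) = cos (a * u)" "cos (a * (1 - u)) = cos (a * u)"
      by (simp_all add: a_def ring_distribs cos_add cos_diff)
    have u2: "1 - u\<^sup>2 = (1 + u) * (1 - u)" by (simp add: power2_eq_square algebra_simps)
    show ?thesis
      unfolding u2 a_def[symmetric] using a u
      by (simp add: c divide_simps power2_eq_square) (simp add: algebra_simps)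
  qed
  ultimately show ?thesis by simp
qed

lemma selberg_weight_cos_integral_nonpos:
  assumes "0 < \<epsilon>" "\<epsilon> < \<bar>v\<bar>"
  shows "integral {0..1} (\<lambda>t. selberg_weight t * cos (2 * pi / \<epsilon> * t * v)) \<le> 0"
proof -
  define u where "u = v / \<epsilon>"
  have u: "1 < \<bar>u\<bar>" using assms by (simp add: u_def)
  then have u2: "1 < u\<^sup>2" using one_less_power[of "\<bar>u\<bar>" 2] by simp
  have "integral {0..1} (\<lambda>t. selberg_weight t * cos (2 * pi / \<epsilon> * t * v))
      = integral {0..1} (\<lambda>t. selberg_weight t * cos (2 * pi * u * t))"
    by (simp add: u_def mult_ac)
  also have "\<dots> = (1 - cos (2 * pi * u)) / ((2 * pi)\<^sup>2 * u\<^sup>2 * (1 - u\<^sup>2))"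
    using selberg_weight_cos_integral[OF u] by (rule integral_unique)
  also have "\<dots> \<le> 0"
    using u u2 by (intro divide_nonneg_neg mult_pos_neg mult_pos_pos) auto
  finally show ?thesis .
qed

section \<open>Passage to the line \<open>Re s = 1\<close> and prime powers near
  \<open>exp y\<close>\<close>

text \<open>Termwise, the integral is a nonnegative multiple of the cosine transform at
  \<open>y - ln n\<close>. By the gap assumption that transform is nonpositive at every prime power,
  and the other coefficients vanish. Dominated convergence carries this from the partial sums to the
  series.\<close>

lemma mangoldt_series_kernel_nonpos:
  assumes \<epsilon>: "0 < \<epsilon>" and \<sigma>: "1 < \<sigma>"
    and gap: "\<And>n. primepow n \<Longrightarrow> \<epsilon> < \<bar>ln (real n) - y\<bar>"
  defines "b \<equiv> 2 * pi / \<epsilon>"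
  shows "integral {0..1} (\<lambda>t. selberg_weight t * Re (cis (b * y * t) * mangoldt_series (of_real \<sigma> + \<i> * of_real (b * t)))) \<le> 0"
    "(\<lambda>t. selberg_weight t * Re (cis (b * y * t) * mangoldt_series (of_real \<sigma> + \<i> * of_real (b * t)))) integrable_on {0..1}"
proof -
  define c where "c n = mangoldt n * real n powr (- \<sigma>)" for n
  have c0: "c n \<ge> 0" for n by (simp add: c_def mangoldt_nonneg)
  define f where "f N t = (\<Sum>n<N. c n * (selberg_weight t * cos (b * t * (y - ln (real n)))))" for N t
  define g where "g t = selberg_weight t * Re (cis (b * y * t) * mangoldt_series (of_real \<sigma> + \<i> * of_real (b * t)))" for t
  have sc: "summable c"
  proof -
    have "norm (mangoldt n * of_nat n powr (- of_real \<sigma>) :: complex) = c n" for n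
      by (cases "n = 0") (auto simp: c_def norm_mult norm_of_nat_powr)
    then show ?thesis
      using summable_dirichlet[OF norm_mangoldt_le_ln, of "of_real \<sigma>"] \<sigma> by simp
  qed
  have lim: "(\<lambda>N. f N t) \<longlonglongrightarrow> g t" for t
  proof -
    have "(\<lambda>n. Re (cis (b * y * t) * (of_real (c n) * cis (- ((b * t) * ln (real n))))))
       sums Re (cis (b * y * t) * mangoldt_series (of_real \<sigma> + \<i> * of_real (b * t)))"
      unfolding c_def mangoldt_term_polar[symmetric]
      by (intro sums_Re sums_mult mangoldt_series_sums) (use \<sigma> in auto)
    moreover have "Re (cis (b * y * t) * (of_real (c n) * cis (- ((b * t) * ln (real n))))) = c n * cos (b * t * (y - ln (real n)))" for n
    proof -
      have "cis (b * y * t) * (of_real (c n) * cis (- ((b * t) * ln (real n)))) = of_real (c n) * (cis (b * y * t) * cis (- ((b * t) * ln (real n))))"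
        by (simp only: mult_ac)
      also have "\<dots> = of_real (c n) * cis (b * t * (y - ln (real n)))"
        unfolding cis_mult by (simp add: algebra_simps)
      finally have e: "cis (b * y * t) * (of_real (c n) * cis (- ((b * t) * ln (real n)))) = of_real (c n) * cis (b * t * (y - ln (real n)))" .
      show ?thesis unfolding e by simp
    qed
    ultimately have "(\<lambda>n. c n * cos (b * t * (y - ln (real n)))) sums Re (cis (b * y * t) * mangoldt_series (of_real \<sigma> + \<i> * of_real (b * t)))"
      by (simp only:)
    from sums_mult[OF this, of "selberg_weight t"] show ?thesis
      by (simp add: sums_def f_def g_def mult_ac)
  qed
  have int: "f N integrable_on {0..1}" for N
    unfolding f_def by (intro integrable_continuous_real continuous_intros)
  have bd: "norm (f N t) \<le> 2 * suminf c" if "t \<in> {0..1}" for N t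
  proof -
    have "norm (f N t) \<le> (\<Sum>n<N. c n * 2)"
      unfolding f_def
    proof (rule sum_norm_le)
      fix n
      have "\<bar>selberg_weight t\<bar> * \<bar>cos (b * t * (y - ln (real n)))\<bar> \<le> 2 * 1"
        using selberg_weight_nonneg[OF that] selberg_weight_le[OF that] by (intro mult_mono) auto
      then show "norm (c n * (selberg_weight t * cos (b * t * (y - ln (real n))))) \<le> c n * 2"
        using c0[of n] by (simp add: abs_mult mult_left_mono)
    qed
    also have "\<dots> = 2 * (\<Sum>n<N. c n)" by (simp add: sum_distrib_right[symmetric])
    also have "\<dots> \<le> 2 * suminf c" using sum_le_suminf[OF sc, of "{..<N}"] c0 by simp
    finally show ?thesis .
  qed
  note dc = dominated_convergence[OF int integrable_const_ivl bd lim]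
  have "integral {0..1} (f N) \<le> 0" for N
  proof -
    have "integral {0..1} (f N) = (\<Sum>n<N. integral {0..1} (\<lambda>t. c n * (selberg_weight t * cos (b * t * (y - ln (real n))))))"
      unfolding f_def by (intro integral_sum integrable_continuous_real continuous_intros) auto
    also have "\<dots> = (\<Sum>n<N. c n * integral {0..1} (\<lambda>t. selberg_weight t * cos (b * t * (y - ln (real n)))))"
      by simp
    also have "\<dots> \<le> 0"
    proof (rule sum_nonpos)
      fix n
      show "c n * integral {0..1} (\<lambda>t. selberg_weight t * cos (b * t * (y - ln (real n)))) \<le> 0"
      proof (cases "primepow n")
        case True
        then have "\<epsilon> < \<bar>y - ln (real n)\<bar>" using gap[of n] by linarith
        then show ?thesis unfolding b_def
          by (intro mult_nonneg_nonpos c0 selberg_weight_cos_integral_nonpos \<epsilon>)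
      qed (simp add: c_def mangoldt_def)
    qed
    finally show ?thesis .
  qed
  then have "integral {0..1} g \<le> 0"
    by (intro LIMSEQ_le_const2[OF dc(2)]) auto
  then show "integral {0..1} (\<lambda>t. selberg_weight t * Re (cis (b * y * t) * mangoldt_series (of_real \<sigma> + \<i> * of_real (b * t)))) \<le> 0"
    by (simp only: g_def[abs_def])
  show "(\<lambda>t. selberg_weight t * Re (cis (b * y * t) * mangoldt_series (of_real \<sigma> + \<i> * of_real (b * t)))) integrable_on {0..1}"
    using dc(1) by (simp only: g_def[abs_def])
qed

text \<open>This is \<open>- zeta'/zeta\<close> minus its pole \<open>1 / (s - 1)\<close>, hence
  continuous up to the line \<open>Re s = 1\<close>.\<close>

definition mangoldt_regular :: "complex \<Rightarrow> complex" where
  "mangoldt_regular s = - deriv zeta_pole_free s / zeta_pole_free s"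

lemma continuous_on_mangoldt_regular: "continuous_on {s. 1 \<le> Re s} mangoldt_regular"
proof -
  have "deriv zeta_pole_free holomorphic_on {s. 0 < Re s}"
    using holomorphic_zeta_pole_free by (intro holomorphic_deriv open_halfspace_Re_gt)
  then have "continuous_on {s. 0 < Re s} (deriv zeta_pole_free)" "continuous_on {s. 0 < Re s} zeta_pole_free"
    using holomorphic_zeta_pole_free by (auto intro: holomorphic_on_imp_continuous_on)
  then have "continuous_on {s. 1 \<le> Re s} (deriv zeta_pole_free)" "continuous_on {s. 1 \<le> Re s} zeta_pole_free"
    by (auto elim!: continuous_on_subset)
  then show ?thesis unfolding mangoldt_regular_def
    by (intro continuous_intros) (use zeta_pole_free_nonzero in auto)
qed

lemma mangoldt_series_decompose:
  assumes "1 < Re s"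
  shows "mangoldt_series s = mangoldt_regular s + 1 / (s - 1)"
  using deriv_zeta_pole_free[OF assms] zeta_pole_free_nonzero[of s] assms
  by (simp add: mangoldt_regular_def mangoldt_series_def field_simps)

lemma Re_cis_div:
  fixes \<delta> t \<theta> :: real
  shows "Re (cis \<theta> / (of_real \<delta> + \<i> * of_real t)) = (\<delta> * cos \<theta> + t * sin \<theta>) / (\<delta>\<^sup>2 + t\<^sup>2)"
  by (simp add: Re_divide mult_ac)

text \<open>Let the real part \<open>1 + d k\<close> decrease to 1. The pole contributes a sine
  part, which converges dominatedly, and a cosine part that acts like a point mass at 0. That mass
  is nonnegative up to an error \<open>C * d k\<close>, so discarding it keeps the
  inequality.\<close>

lemma prime_power_gap_integral_nonpos:
  assumes \<epsilon>: "0 < \<epsilon>" and y: "0 < y"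
    and gap: "\<And>n. primepow n \<Longrightarrow> \<epsilon> < \<bar>ln (real n) - y\<bar>"
  defines "b \<equiv> 2 * pi / \<epsilon>"
  shows "integral {0..1} (\<lambda>t. selberg_weight t * (sin (b * y * t) / (b * t))
     + selberg_weight t * Re (cis (b * y * t) * mangoldt_regular (1 + \<i> * of_real (b * t)))) \<le> 0"
proof -
  have b: "b > 0" using \<epsilon> by (simp add: b_def)
  \<comment> \<open>For \<open>t <= t0\<close> the argument \<open>b * y * t\<close> is at most
    \<open>pi / 2\<close>, so the cosine is nonnegative.\<close>
  define t0 where "t0 = pi / (2 * b * y)"
  have t0: "t0 > 0" using b y by (simp add: t0_def)
  \<comment> \<open>Beyond \<open>t0\<close> the denominator is at least \<open>b^2 * t0^2\<close>;
    the factor 2 bounds the weight.\<close>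
  define C where "C = 2 / (b\<^sup>2 * t0\<^sup>2)"
  have C: "C > 0" using b t0 by (simp add: C_def)
  define d where "d k = 1 / real (Suc k)" for k :: nat
  have d: "d k > 0" "d k \<le> 1" for k by (auto simp: d_def)
  have dlim: "d \<longlonglongrightarrow> 0" unfolding d_def by (rule LIMSEQ_inverse_real_of_nat[unfolded inverse_eq_divide])
  \<comment> \<open>A compact box containing all the line segments used, for a bound on
    \<open>mangoldt_regular\<close> uniform in \<open>k\<close>.\<close>
  let ?K = "cbox (1::complex) (2 + \<i> * of_real b)"
  have K: "?K \<subseteq> {s. 1 \<le> Re s}" by (auto simp: in_cbox_complex_iff)
  have inK: "1 + of_real x + \<i> * of_real (b * t) \<in> ?K" if "0 \<le> x" "x \<le> 1" "t \<in> {0..1}" for x t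
    using that b by (auto simp: in_cbox_complex_iff)
  obtain M where M: "\<And>s. s \<in> ?K \<Longrightarrow> norm (mangoldt_regular s) \<le> M"
    using compact_imp_bounded[OF compact_continuous_image[OF continuous_on_subset[OF continuous_on_mangoldt_regular K] compact_cbox]]
    unfolding bounded_iff by blast
  define f where "f k t = selberg_weight t * (b * t * sin (b * y * t) / ((d k)\<^sup>2 + (b * t)\<^sup>2))
     + selberg_weight t * Re (cis (b * y * t) * mangoldt_regular (1 + of_real (d k) + \<i> * of_real (b * t)))" for k t
  define g where "g t = selberg_weight t * (sin (b * y * t) / (b * t))
     + selberg_weight t * Re (cis (b * y * t) * mangoldt_regular (1 + of_real 0 + \<i> * of_real (b * t)))" for t
  have int: "f k integrable_on {0..1}" for k
  proof -
    have "continuous_on {0..1} (\<lambda>t. mangoldt_regular (1 + of_real (d k) + \<i> * of_real (b * t)))"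
      using K inK[of "d k"] d[of k] less_imp_le[OF d(1)]
      by (intro continuous_on_compose2[OF continuous_on_mangoldt_regular] continuous_intros) auto
    moreover have "(d k)\<^sup>2 + (b * t)\<^sup>2 \<noteq> 0" for t using d(1)[of k] by (simp add: sum_power2_eq_zero_iff)
    ultimately show ?thesis unfolding f_def
      by (intro integrable_continuous_real continuous_intros) auto
  qed
  have w: "0 \<le> selberg_weight t" "selberg_weight t \<le> 2" if "t \<in> {0..1}" for t
    using that by (auto intro: selberg_weight_nonneg selberg_weight_le)
  have bd: "norm (f k t) \<le> 2 * y + 2 * M" if t: "t \<in> {0..1}" for k t
  proof -
    have "\<bar>b * t * sin (b * y * t)\<bar> \<le> b * t * (b * y * t)"
      using t b y abs_sin_x_le_abs_x[of "b * y * t"] by (simp add: abs_mult mult_left_mono)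
    also have "\<dots> \<le> y * ((d k)\<^sup>2 + (b * t)\<^sup>2)"
      using y by (simp add: power2_eq_square algebra_simps)
    finally have "\<bar>b * t * sin (b * y * t) / ((d k)\<^sup>2 + (b * t)\<^sup>2)\<bar> \<le> y"
      using d(1)[of k] by (simp add: divide_le_eq add_pos_nonneg)
    then have 1: "norm (selberg_weight t * (b * t * sin (b * y * t) / ((d k)\<^sup>2 + (b * t)\<^sup>2))) \<le> 2 * y"
      using w[OF t] unfolding norm_mult by (intro mult_mono) auto
    have "norm (cis (b * y * t) * mangoldt_regular (1 + of_real (d k) + \<i> * of_real (b * t))) \<le> M"
      using M[OF inK[of "d k" t]] d[of k] t by (simp add: norm_mult)
    then have "\<bar>Re (cis (b * y * t) * mangoldt_regular (1 + of_real (d k) + \<i> * of_real (b * t)))\<bar> \<le> M"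
      using abs_Re_le_cmod order_trans by blast
    then have 2: "norm (selberg_weight t * Re (cis (b * y * t) * mangoldt_regular (1 + of_real (d k) + \<i> * of_real (b * t)))) \<le> 2 * M"
      using w[OF t] unfolding norm_mult by (intro mult_mono) auto
    show ?thesis unfolding f_def by (rule norm_triangle_le[OF add_mono[OF 1 2]])
  qed
  have lim: "(\<lambda>k. f k t) \<longlonglongrightarrow> g t" if t: "t \<in> {0..1}" for t
  proof -
    have "(\<lambda>k. 1 + of_real (d k) + \<i> * of_real (b * t)) \<longlonglongrightarrow> 1 + of_real 0 + \<i> * of_real (b * t)"
      by (intro tendsto_intros dlim)
    then have "(\<lambda>k. mangoldt_regular (1 + of_real (d k) + \<i> * of_real (b * t))) \<longlonglongrightarrow> mangoldt_regular (1 + of_real 0 + \<i> * of_real (b * t))"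
      by (rule continuous_on_tendsto_compose[OF continuous_on_mangoldt_regular])
         (use d(1) in \<open>auto simp: less_imp_le\<close>)
    moreover have "(\<lambda>k. b * t * sin (b * y * t) / ((d k)\<^sup>2 + (b * t)\<^sup>2)) \<longlonglongrightarrow> sin (b * y * t) / (b * t)"
    \<comment> \<open>At \<open>t = 0\<close> both sides are 0, the right one because
      \<open>x / 0 = 0\<close>.\<close>
    proof (cases "t = 0")
      case False
      then have "(\<lambda>k. b * t * sin (b * y * t) / ((d k)\<^sup>2 + (b * t)\<^sup>2)) \<longlonglongrightarrow> b * t * sin (b * y * t) / (0\<^sup>2 + (b * t)\<^sup>2)"
        using b by (intro tendsto_intros dlim) auto
      then show ?thesis using False b by (simp add: power2_eq_square)
    qed simp
    ultimately show ?thesis unfolding f_def g_def by (intro tendsto_add tendsto_mult tendsto_const tendsto_Re)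
  qed
  note dc = dominated_convergence[OF int integrable_const_ivl bd lim]
  have le: "integral {0..1} (f k) \<le> C * d k" for k
  proof -
    let ?h = "\<lambda>t. selberg_weight t * Re (cis (b * y * t) * mangoldt_series (of_real (1 + d k) + \<i> * of_real (b * t)))"
    have h: "integral {0..1} ?h \<le> 0" "?h integrable_on {0..1}"
      using mangoldt_series_kernel_nonpos[OF \<epsilon> _ gap, of "1 + d k"] d(1)[of k] unfolding b_def by auto
    have "integral {0..1} (f k) \<le> integral {0..1} (\<lambda>t. ?h t + C * d k)"
    proof (rule integral_le[OF int])
      show "(\<lambda>t. ?h t + C * d k) integrable_on {0..1}"
        by (intro integrable_add h(2) integrable_const_ivl)
      fix t :: real assume t: "t \<in> {0..1}"
      have "mangoldt_series (of_real (1 + d k) + \<i> * of_real (b * t)) =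
         mangoldt_regular (1 + of_real (d k) + \<i> * of_real (b * t)) + 1 / (of_real (d k) + \<i> * of_real (b * t))"
        using d(1)[of k] by (subst mangoldt_series_decompose) (auto simp: algebra_simps)
      then have "?h t = f k t + selberg_weight t * (d k * cos (b * y * t) / ((d k)\<^sup>2 + (b * t)\<^sup>2))"
        using Re_cis_div[of "b * y * t" "d k" "b * t"]
        by (simp add: f_def ring_distribs add_divide_distrib)
      moreover have "- (C * d k) \<le> selberg_weight t * (d k * cos (b * y * t) / ((d k)\<^sup>2 + (b * t)\<^sup>2))"
      proof (cases "t \<le> t0")
        case True
        then have "b * y * t \<le> pi / 2" using b y by (simp add: t0_def field_simps)
        moreover have "0 \<le> b * y * t" using b y t by simp
        ultimately have "0 \<le> cos (b * y * t)" by (intro cos_ge_zero) auto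
        then have "0 \<le> selberg_weight t * (d k * cos (b * y * t) / ((d k)\<^sup>2 + (b * t)\<^sup>2))"
          using w[OF t] d(1)[of k] by (intro mult_nonneg_nonneg divide_nonneg_nonneg) auto
        moreover have "0 \<le> C * d k" using C d(1)[of k] by simp
        ultimately show ?thesis by linarith
      next
        case False
        have "\<bar>d k * cos (b * y * t) / ((d k)\<^sup>2 + (b * t)\<^sup>2)\<bar> \<le> d k / (b\<^sup>2 * t0\<^sup>2)"
          unfolding abs_divide
        proof (rule frac_le)
          show "\<bar>d k * cos (b * y * t)\<bar> \<le> d k" using d(1)[of k] by (simp add: abs_mult mult_left_le)
          have "b\<^sup>2 * t0\<^sup>2 \<le> (b * t)\<^sup>2"
            using False t0 by (simp add: power_mult_distrib mult_left_mono power_mono)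
          also have "\<dots> \<le> (d k)\<^sup>2 + (b * t)\<^sup>2" by simp
          finally show "b\<^sup>2 * t0\<^sup>2 \<le> \<bar>(d k)\<^sup>2 + (b * t)\<^sup>2\<bar>" by simp
        qed (use b t0 d(1)[of k] in auto)
        then have "\<bar>selberg_weight t * (d k * cos (b * y * t) / ((d k)\<^sup>2 + (b * t)\<^sup>2))\<bar> \<le> 2 * (d k / (b\<^sup>2 * t0\<^sup>2))"
          using w[OF t] unfolding abs_mult by (intro mult_mono) auto
        also have "\<dots> = C * d k" by (simp add: C_def)
        finally show ?thesis by linarith
      qed
      ultimately show "f k t \<le> ?h t + C * d k" by linarith
    qed
    also have "\<dots> = integral {0..1} ?h + C * d k"
      by (subst integral_add[OF h(2)]) (auto intro: integrable_const_ivl)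
    finally show ?thesis using h(1) by linarith
  qed
  have "(\<lambda>k. C * d k) \<longlonglongrightarrow> C * 0" by (intro tendsto_intros dlim)
  then have "integral {0..1} g \<le> C * 0"
    using le by (intro LIMSEQ_le[OF dc(2)]) auto
  then show ?thesis by (simp add: g_def[abs_def])
qed

text \<open>The integral of the preceding lemma equals \<open>Si (b * y) / b\<close> plus an
  oscillatory integral. As \<open>y\<close> grows the former tends to \<open>pi / (2 * b)\<close>
  and the latter to 0, so the sum becomes positive and a gap around \<open>y\<close> is
  impossible.\<close>

theorem primepow_near_exp:
  assumes \<epsilon>: "0 < \<epsilon>"
  shows "\<forall>\<^sub>F y in at_top. \<exists>n. primepow n \<and> \<bar>ln (real n) - y\<bar> \<le> \<epsilon>"
proof -
  define b where "b = 2 * pi / \<epsilon>"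
  have b: "b > 0" using \<epsilon> by (simp add: b_def)
  \<comment> \<open>All continuous contributions: the regular part, and what remains of
    \<open>selberg_weight t / (b * t)\<close> after removing \<open>1 / (b * t)\<close>. The factor
    \<open>- i\<close> makes the latter appear with a sine in the real part.\<close>
  define \<Psi> where "\<Psi> t = of_real (selberg_weight t) * mangoldt_regular (1 + \<i> * of_real (b * t)) - \<i> * of_real ((sinc (2 * pi * t) - 1) / b)" for t
  have c\<Psi>: "continuous_on {0..1} \<Psi>"
  proof -
    have "continuous_on {0..1} (\<lambda>t. mangoldt_regular (1 + \<i> * of_real (b * t)))"
      by (intro continuous_on_compose2[OF continuous_on_mangoldt_regular] continuous_intros) auto
    moreover have "continuous_on {0..1} (\<lambda>t. sinc (2 * pi * t))"
      by (rule continuous_on_compose2[of UNIV sinc])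
         (auto intro!: continuous_intros continuous_at_imp_continuous_on isCont_sinc)
    ultimately show ?thesis unfolding \<Psi>_def using b
      by (intro continuous_intros) auto
  qed
  have F: "filterlim (\<lambda>y. b * y) at_top at_top"
    using b by (intro filterlim_tendsto_pos_mult_at_top[OF tendsto_const _ filterlim_ident])
  have "((\<lambda>y. Si (b * y) / b + Re (integral {0..1} (\<lambda>t. \<Psi> t * cis (b * y * t)))) \<longlongrightarrow> (pi / 2) / b + Re 0) at_top"
    using b by (intro tendsto_intros filterlim_compose[OF Si_at_top F]
        filterlim_compose[OF Riemann_Lebesgue_unit_interval[OF c\<Psi>] F]) auto
  then have "\<forall>\<^sub>F y in at_top. 0 < Si (b * y) / b + Re (integral {0..1} (\<lambda>t. \<Psi> t * cis (b * y * t)))"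
    by (rule order_tendstoD(1)) (use b in auto)
  then show ?thesis using eventually_gt_at_top[of 0]
  proof eventually_elim
    case (elim y)
    have ci: "(\<lambda>t. \<Psi> t * cis (b * y * t)) integrable_on {0..1}"
      by (intro integrable_continuous_real continuous_intros c\<Psi>)
    have "((\<lambda>t. y * sinc (b * y * t)) has_integral Si (b * y * 1) / b - Si (b * y * 0) / b) {0..1}"
    proof (rule fundamental_theorem_of_calculus)
      fix t :: real
      have "((\<lambda>t. Si (b * y * t) / b) has_real_derivative (sinc (b * y * t) * (b * y)) / b) (at t within {0..1})"
        by (intro DERIV_cdivide DERIV_chain2[OF DERIV_Si]) (auto intro!: derivative_eq_intros)
      then show "((\<lambda>t. Si (b * y * t) / b) has_vector_derivative y * sinc (b * y * t)) (at t within {0..1})"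
        using b by (simp add: has_real_derivative_iff_has_vector_derivative mult_ac)
    qed simp
    then have si: "((\<lambda>t. y * sinc (b * y * t)) has_integral Si (b * y) / b) {0..1}"
      using Si_neg[of 0] by simp
    have ri: "((\<lambda>t. Re (\<Psi> t * cis (b * y * t))) has_integral Re (integral {0..1} (\<lambda>t. \<Psi> t * cis (b * y * t)))) {0..1}"
      using has_integral_linear[OF integrable_integral[OF ci] bounded_linear_Re] by (simp add: o_def)
    have "((\<lambda>t. selberg_weight t * (sin (b * y * t) / (b * t))
     + selberg_weight t * Re (cis (b * y * t) * mangoldt_regular (1 + \<i> * of_real (b * t))))
      has_integral Si (b * y) / b + Re (integral {0..1} (\<lambda>t. \<Psi> t * cis (b * y * t)))) {0..1}"
    \<comment> \<open>The integrands may differ at \<open>t = 0\<close>, where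
      \<open>sin 0 / 0 = 0\<close> but \<open>sinc 0 = 1\<close>.\<close>
    proof (rule has_integral_spike_finite[OF _ _ has_integral_add[OF si ri]])
      fix t :: real assume "t \<in> {0..1} - {0}"
      then have t: "t \<noteq> 0" by auto
      have "selberg_weight t = 1 + t * (sinc (2 * pi * t) - 1)"
        using t by (simp add: selberg_weight_def field_simps)
      then have e: "selberg_weight t * (sin (b * y * t) / (b * t)) = y * sinc (b * y * t) + (sinc (2 * pi * t) - 1) / b * sin (b * y * t)"
      proof -
        have "(1 + t * r) * (S / (b * t)) = S / (b * t) + r / b * S" for r S
          using t b by (simp add: field_simps)
        moreover have "y * sinc (b * y * t) = sin (b * y * t) / (b * t)"
          using t b elim(2) by simp
        ultimately show ?thesis using \<open>selberg_weight t = _\<close> by simp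
      qed
      have "Re ((of_real w * z - \<i> * of_real r) * cis \<theta>) = w * Re (cis \<theta> * z) + r * sin \<theta>" for w r \<theta> z
        by (simp add: algebra_simps)
      then have R: "Re (\<Psi> t * cis (b * y * t)) = selberg_weight t * Re (cis (b * y * t) * mangoldt_regular (1 + \<i> * of_real (b * t)))
          + (sinc (2 * pi * t) - 1) / b * sin (b * y * t)"
        unfolding \<Psi>_def .
      show "selberg_weight t * (sin (b * y * t) / (b * t))
     + selberg_weight t * Re (cis (b * y * t) * mangoldt_regular (1 + \<i> * of_real (b * t)))
        = y * sinc (b * y * t) + Re (\<Psi> t * cis (b * y * t))"
        by (simp only: e R add_ac)
    qed simp
    then have "0 < integral {0..1} (\<lambda>t. selberg_weight t * (sin (b * y * t) / (b * t))
     + selberg_weight t * Re (cis (b * y * t) * mangoldt_regular (1 + \<i> * of_real (b * t))))"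
      using elim(1) by (simp only: integral_unique)
    then show ?case
      using prime_power_gap_integral_nonpos[OF \<epsilon> elim(2)] unfolding b_def
      by (meson not_le)
  qed
qed

text \<open>Apply the theorem at \<open>y = ln x + 2 * \<eta>\<close> with radius
  \<open>\<eta>\<close>, where \<open>3 * \<eta> = ln (1 + \<epsilon>)\<close>.\<close>

corollary primepow_between:
  assumes \<epsilon>: "0 < (\<epsilon>::real)"
  shows "\<forall>\<^sub>F x in at_top. \<exists>q. primepow q \<and> x < real q \<and> real q \<le> (1 + \<epsilon>) * x"
proof -
  define \<eta> where "\<eta> = ln (1 + \<epsilon>) / 3"
  have \<eta>: "\<eta> > 0" using \<epsilon> by (simp add: \<eta>_def)
  have "filterlim (\<lambda>x::real. 2 * \<eta> + ln x) at_top at_top"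
    by (intro filterlim_tendsto_add_at_top[OF tendsto_const] ln_at_top)
  from eventually_compose_filterlim[OF primepow_near_exp[OF \<eta>] this] eventually_gt_at_top[of 0]
  show ?thesis
  proof eventually_elim
    case (elim x)
    then obtain n where n: "primepow n" "\<bar>ln (real n) - (2 * \<eta> + ln x)\<bar> \<le> \<eta>" by auto
    have "n > 0" using n(1) by (rule primepow_gt_0_nat)
    have "ln x < ln (real n)" using n(2) \<eta> by linarith
    then have "x < real n" using elim \<open>n > 0\<close> by simp
    have "ln (real n) \<le> 3 * \<eta> + ln x" using n(2) by linarith
    also have "\<dots> = ln ((1 + \<epsilon>) * x)" using \<epsilon> elim by (simp add: \<eta>_def ln_mult)
    finally have "real n \<le> (1 + \<epsilon>) * x" using \<open>n > 0\<close> elim \<epsilon> by simp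
    then show ?case using n(1) \<open>x < real n\<close> by blast
  qed
qed

section \<open>Ternary vectors avoiding a distance\<close>

text \<open>Fraction-free Gaussian elimination, one coordinate \<open>b\<close> at a time, with a
  pivot \<open>a\<close> such that \<open>g a b\<close> is nonzero.\<close>

lemma integer_dependency:
  fixes g :: "'a \<Rightarrow> 'b \<Rightarrow> int"
  assumes "finite B" "finite A" "card B < card A"
  shows "\<exists>c. (\<exists>x\<in>A. c x \<noteq> 0) \<and> (\<forall>b\<in>B. (\<Sum>x\<in>A. c x * g x b) = 0)"
  using assms
proof (induction B arbitrary: A g rule: finite_induct)
  case empty
  then have "A \<noteq> {}" by auto
  then show ?case by (intro exI[of _ "\<lambda>_. 1"]) auto
next
  case (insert b B)
  show ?case
  proof (cases "\<forall>x\<in>A. g x b = 0")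
    case True
    obtain c where "\<exists>x\<in>A. c x \<noteq> 0" "\<forall>b\<in>B. (\<Sum>x\<in>A. c x * g x b) = 0"
      using insert.IH[of A g] insert.prems insert.hyps by auto
    then show ?thesis using True by (intro exI[of _ c]) auto
  next
    case False
    then obtain a where a: "a \<in> A" "g a b \<noteq> 0" by auto
    define A' where "A' = A - {a}"
    have A: "A = insert a A'" "a \<notin> A'" "finite A'" using a insert.prems by (auto simp: A'_def)
    then have "card B < card A'" using insert.prems insert.hyps by auto
    then obtain c where c: "\<exists>x\<in>A'. c x \<noteq> 0"
      "\<And>b'. b' \<in> B \<Longrightarrow> (\<Sum>x\<in>A'. c x * (g a b * g x b' - g x b * g a b')) = 0"
      using insert.IH[of A' "\<lambda>x b'. g a b * g x b' - g x b * g a b'"] A by auto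
    \<comment> \<open>The coefficient of the pivot is chosen to cancel coordinate \<open>b\<close>;
      the others are scaled by \<open>g a b\<close> to stay integral.\<close>
    define c' where "c' x = (if x = a then - (\<Sum>x\<in>A'. c x * g x b) else g a b * c x)" for x
    have s: "(\<Sum>x\<in>A. c' x * g x b') = - (\<Sum>x\<in>A'. c x * g x b) * g a b' + (\<Sum>x\<in>A'. g a b * c x * g x b')" for b'
    proof -
      have "(\<Sum>x\<in>A'. c' x * g x b') = (\<Sum>x\<in>A'. g a b * c x * g x b')"
        using A by (intro sum.cong) (auto simp: c'_def)
      then show ?thesis using A by (simp add: c'_def)
    qed
    have "(\<Sum>x\<in>A. c' x * g x b') = 0" if "b' \<in> insert b B" for b'
    proof (cases "b' = b")
      case True
      then show ?thesis unfolding s by (simp add: sum_distrib_left sum_distrib_right mult_ac)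
    next
      case False
      then have "(\<Sum>x\<in>A'. c x * (g a b * g x b' - g x b * g a b')) = 0" using c(2) that by auto
      then show ?thesis unfolding s
        by (simp add: sum_distrib_left sum_distrib_right right_diff_distrib sum_subtractf mult_ac)
    qed
    moreover have "\<exists>x\<in>A. c' x \<noteq> 0" using c(1) A a by (auto simp: c'_def)
    ultimately show ?thesis by blast
  qed
qed

text \<open>Divide a nontrivial dependency by the gcd of its coefficients. Integers are kept instead
  of residues modulo \<open>p\<close> because \<open>(q - 1)!\<close> has to be cancelled
  later.\<close>

lemma integer_dependency_not_all_dvd:
  fixes g :: "'a \<Rightarrow> 'b \<Rightarrow> int" and p :: int
  assumes "finite B" "finite A" "card B < card A" and p: "1 < p"
  shows "\<exists>c. (\<exists>x\<in>A. \<not> p dvd c x) \<and> (\<forall>b\<in>B. (\<Sum>x\<in>A. c x * g x b) = 0)"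
proof -
  obtain c where c: "\<exists>x\<in>A. c x \<noteq> 0" "\<And>b. b \<in> B \<Longrightarrow> (\<Sum>x\<in>A. c x * g x b) = 0"
    using integer_dependency[OF assms(1-3), of g] by blast
  define d where "d = Gcd (c ` A)"
  have d: "d \<noteq> 0" using c(1) by (auto simp: d_def Gcd_0_iff)
  define c' where "c' x = c x div d" for x
  have cc: "c x = d * c' x" if "x \<in> A" for x using that by (simp add: c'_def d_def)
  have "(\<Sum>x\<in>A. c' x * g x b) = 0" if "b \<in> B" for b
  proof -
    have "d * (\<Sum>x\<in>A. c' x * g x b) = (\<Sum>x\<in>A. c x * g x b)"
      unfolding sum_distrib_left by (intro sum.cong) (auto simp: cc)
    then show ?thesis using c(2)[OF that] d by simp
  qed
  moreover have "\<exists>x\<in>A. \<not> p dvd c' x"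
  proof (rule ccontr)
    assume "\<not> ?thesis"
    then have "d * p dvd z" if "z \<in> c ` A" for z using that cc by auto
    then have "d * p dvd d" unfolding d_def by (rule Gcd_greatest)
    then show False using d p by (simp add: dvd_mult_cancel_left) 
  qed
  ultimately show ?thesis by blast
qed

lemma fact_mult_binomial_eq_prod:
  assumes "q \<le> n" "0 < q"
  shows "(\<Prod>j\<in>{1..<q}. int n - int j) = int (fact (q - 1) * ((n - 1) choose (q - 1)))"
proof -
  have "real_of_int (\<Prod>j\<in>{1..<q}. int n - int j) = (\<Prod>j\<in>{1..<q}. real n - real j)" by simp
  also have "\<dots> = (\<Prod>i = 0..<q-1. real (n - 1) - real i)"
    using assms by (intro prod.reindex_bij_witness[of _ "\<lambda>i. i + 1" "\<lambda>j. j - 1"]) (auto simp: of_nat_diff)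
  also have "\<dots> = fact (q - 1) * (real (n - 1) gchoose (q - 1))"
    by (rule gbinomial_mult_fact[symmetric])
  also have "\<dots> = real_of_int (int (fact (q - 1) * ((n - 1) choose (q - 1))))"
    by (simp add: binomial_gbinomial)
  finally show ?thesis by (simp only: of_int_eq_iff)
qed

text \<open>For \<open>u < q\<close> a factor is zero. For \<open>q < u < 2 * q\<close> the product
  is \<open>(q - 1)!\<close> times \<open>(u - 1) choose (q - 1)\<close>, and
  \<open>u * ((u - 1) choose (q - 1)) = q * (u choose q)\<close>. As \<open>q = p ^ k\<close> does
  not divide \<open>u\<close>, the prime \<open>p\<close> divides the binomial coefficient.\<close>

lemma prime_dvd_prod_prime_power:
  fixes u :: int and p k :: nat
  assumes p: "prime p" and k: "0 < k" and q: "q = p ^ k" and u: "0 < u" "u < 2 * int q" "u \<noteq> int q"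
  shows "int p * fact (q - 1) dvd (\<Prod>j\<in>{1..<q}. u - int j)"
proof (cases "u < int q")
  case True
  then have "(\<Prod>j\<in>{1..<q}. u - int j) = 0" using u by (intro prod_zero bexI[of _ "nat u"]) auto
  then show ?thesis by (simp only: dvd_0_right)
next
  case False
  define n where "n = nat u"
  have n: "q < n" "n < 2 * q" "u = int n" using False u by (auto simp: n_def)
  have q0: "0 < q" using p q by (simp add: prime_gt_0_nat)
  have "q * (n choose q) = n * ((n - 1) choose (q - 1))" using q0 by (rule times_binomial_minus1_eq)
  then have dv: "p ^ k dvd n * ((n - 1) choose (q - 1))" using q by (metis dvd_triv_left)
  have "p dvd ((n - 1) choose (q - 1))"
  proof (rule ccontr)
    assume "\<not> ?thesis"
    then have "coprime (p ^ k) ((n - 1) choose (q - 1))" using p by (simp add: prime_imp_coprime)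
    then have "q dvd n" using dv q by (simp add: coprime_dvd_mult_left_iff)
    then obtain c where "n = q * c" by auto
    then have "1 < c" "c < 2" using n q0 by auto
    then show False by simp
  qed
  then have "p * fact (q - 1) dvd fact (q - 1) * ((n - 1) choose (q - 1))" by (simp add: mult.commute mult_dvd_mono)
  then have "int (p * fact (q - 1)) dvd int (fact (q - 1) * ((n - 1) choose (q - 1)))" by (simp only: of_nat_dvd_iff)
  then show ?thesis using n fact_mult_binomial_eq_prod[of q n] q0 by simp
qed

section \<open>Polynomial functions on the ternary cube\<close>

definition trit_cube :: "nat \<Rightarrow> (nat \<Rightarrow> int) set" where
  "trit_cube m = {..<m} \<rightarrow>\<^sub>E {-1, 0, 1}"

definition reduced_exponents :: "nat \<Rightarrow> nat \<Rightarrow> (nat \<Rightarrow> nat) set" where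
  "reduced_exponents m d = {e \<in> {..<m} \<rightarrow>\<^sub>E {..2}. sum e {..<m} \<le> d}"

text \<open>Only values on the cube matter, so polynomials are treated as functions and dimensions
  are counted by reduced monomials.\<close>

definition trit_poly :: "nat \<Rightarrow> nat \<Rightarrow> ((nat \<Rightarrow> int) \<Rightarrow> int) \<Rightarrow> bool" where
  "trit_poly m d f \<longleftrightarrow> (\<exists>g. \<forall>y\<in>trit_cube m. f y = (\<Sum>e\<in>reduced_exponents m d. g e * (\<Prod>i<m. y i ^ e i)))"

lemma finite_reduced_exponents [simp]: "finite (reduced_exponents m d)"
  unfolding reduced_exponents_def by (rule finite_subset[OF _ finite_PiE[of "{..<m}" "\<lambda>_. {..2}"]]) auto

lemma finite_trit_cube [simp]: "finite (trit_cube m)"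
  unfolding trit_cube_def by (intro finite_PiE) auto

lemma trit_poly_add:
  assumes "trit_poly m d f" "trit_poly m d g"
  shows "trit_poly m d (\<lambda>y. f y + g y)"
proof -
  obtain a b where "\<forall>y\<in>trit_cube m. f y = (\<Sum>e\<in>reduced_exponents m d. a e * (\<Prod>i<m. y i ^ e i))"
     "\<forall>y\<in>trit_cube m. g y = (\<Sum>e\<in>reduced_exponents m d. b e * (\<Prod>i<m. y i ^ e i))"
    using assms unfolding trit_poly_def by auto
  then show ?thesis unfolding trit_poly_def
    by (intro exI[of _ "\<lambda>e. a e + b e"]) (simp add: sum.distrib ring_distribs)
qed

lemma trit_poly_cmult:
  assumes "trit_poly m d f"
  shows "trit_poly m d (\<lambda>y. c * f y)"
proof -
  obtain a where "\<forall>y\<in>trit_cube m. f y = (\<Sum>e\<in>reduced_exponents m d. a e * (\<Prod>i<m. y i ^ e i))"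
    using assms unfolding trit_poly_def by auto
  then show ?thesis unfolding trit_poly_def
    by (intro exI[of _ "\<lambda>e. c * a e"]) (simp add: sum_distrib_left mult.assoc)
qed

lemma trit_poly_sum:
  assumes "trit_poly m d (\<lambda>_. 0)" "finite I" "\<And>i. i \<in> I \<Longrightarrow> trit_poly m d (f i)"
  shows "trit_poly m d (\<lambda>y. \<Sum>i\<in>I. f i y)"
  using assms(2,3)
proof (induction I rule: finite_induct)
  case empty
  then show ?case using assms(1) by simp
next
  case (insert i I)
  have "trit_poly m d (\<lambda>y. f i y + (\<Sum>i\<in>I. f i y))"
    by (rule trit_poly_add) (use insert in auto)
  then show ?case using insert.hyps by simp
qed

lemma trit_poly_Suc:
  assumes "trit_poly m d f"
  shows "trit_poly m (Suc d) f"
proof -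
  obtain a where a: "\<forall>y\<in>trit_cube m. f y = (\<Sum>e\<in>reduced_exponents m d. a e * (\<Prod>i<m. y i ^ e i))"
    using assms unfolding trit_poly_def by auto
  define b where "b e = (if e \<in> reduced_exponents m d then a e else 0)" for e
  have "(\<Sum>e\<in>reduced_exponents m d. a e * (\<Prod>i<m. y i ^ e i))
    = (\<Sum>e\<in>reduced_exponents m (Suc d). b e * (\<Prod>i<m. y i ^ e i))" for y :: "nat \<Rightarrow> int"
  proof (rule sum.mono_neutral_cong_left)
    show "reduced_exponents m d \<subseteq> reduced_exponents m (Suc d)" unfolding reduced_exponents_def by (rule Collect_mono) (simp add: le_SucI)
  qed (simp_all add: b_def)
  note eq = this
  have "\<forall>y\<in>trit_cube m. f y = (\<Sum>e\<in>reduced_exponents m (Suc d). b e * (\<Prod>i<m. y i ^ e i))"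
  proof
    fix y assume "y \<in> trit_cube m"
    then show "f y = (\<Sum>e\<in>reduced_exponents m (Suc d). b e * (\<Prod>i<m. y i ^ e i))"
      by (rule bspec[OF a, THEN trans[OF _ eq]])
  qed
  then show ?thesis unfolding trit_poly_def by (intro exI[of _ b])
qed

text \<open>Since \<open>y i ^ 3 = y i\<close> on the cube, exponents never need to exceed 2.\<close>

lemma trit_poly_var:
  assumes "trit_poly m d f" and i: "i < m"
  shows "trit_poly m (Suc d) (\<lambda>y. y i * f y)"
proof -
  obtain a where a: "\<And>y. y \<in> trit_cube m \<Longrightarrow> f y = (\<Sum>e\<in>reduced_exponents m d. a e * (\<Prod>i<m. y i ^ e i))"
    using assms unfolding trit_poly_def by auto
  define h where "h e = e(i := if e i = 2 then 1 else Suc (e i))" for e :: "nat \<Rightarrow> nat"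
  have h: "h e \<in> reduced_exponents m (Suc d)" if "e \<in> reduced_exponents m d" for e
  proof -
    have e: "e \<in> {..<m} \<rightarrow>\<^sub>E {..2}" "sum e {..<m} \<le> d" using that by (auto simp: reduced_exponents_def)
    have "e i \<le> 2" using e(1) i by (auto simp: PiE_iff)
    then have "h e i \<le> 2" unfolding h_def fun_upd_same by presburger
    then have "h e j \<in> {..2}" if "j < m" for j
      using that e(1) by (cases "j = i") (auto simp: h_def PiE_iff)
    moreover have "h e j = undefined" if "j \<notin> {..<m}" for j
      using that e(1) i by (auto simp: h_def PiE_iff extensional_def)
    ultimately have "h e \<in> {..<m} \<rightarrow>\<^sub>E {..2}"
      by (auto simp: PiE_iff extensional_def)
    moreover have "sum (h e) {..<m} \<le> Suc (sum e {..<m})"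
    proof -
      have "sum (h e) {..<m} = h e i + sum (h e) ({..<m} - {i})" using i by (intro sum.remove) auto
      also have "sum (h e) ({..<m} - {i}) = sum e ({..<m} - {i})" by (intro sum.cong) (auto simp: h_def)
      also have "h e i \<le> Suc (e i)" by (auto simp: h_def)
      also have "Suc (e i) + sum e ({..<m} - {i}) = Suc (sum e {..<m})"
        using i by (simp add: sum.remove[of "{..<m}" i])
      finally show ?thesis by simp
    qed
    ultimately show ?thesis using e(2) by (simp add: reduced_exponents_def)
  qed
  have mon: "y i * (\<Prod>j<m. y j ^ e j) = (\<Prod>j<m. y j ^ h e j)" if "y \<in> trit_cube m" "e \<in> reduced_exponents m d" for y e
  proof -
    have "(\<Prod>j<m. y j ^ h e j) = y i ^ h e i * (\<Prod>j\<in>{..<m} - {i}. y j ^ h e j)" using i by (intro prod.remove) auto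
    also have "(\<Prod>j\<in>{..<m} - {i}. y j ^ h e j) = (\<Prod>j\<in>{..<m} - {i}. y j ^ e j)"
      by (intro prod.cong) (auto simp: h_def)
    also have "y i ^ h e i = y i * y i ^ e i"
    proof -
      have "y i \<in> {-1, 0, 1}" using that(1) i by (auto simp: trit_cube_def PiE_iff)
      then show ?thesis by (auto simp: h_def)
    qed
    also have "y i * y i ^ e i * (\<Prod>j\<in>{..<m} - {i}. y j ^ e j) = y i * (\<Prod>j<m. y j ^ e j)"
      using i by (simp add: prod.remove[of "{..<m}" i])
    finally show ?thesis by simp
  qed
  \<comment> \<open>Coefficients are collected over the fibres of \<open>h\<close>, which is not
    injective: exponents 0 and 2 at \<open>i\<close> both become 1.\<close>
  have "y i * f y = (\<Sum>e'\<in>reduced_exponents m (Suc d). (\<Sum>e\<in>{e \<in> reduced_exponents m d. h e = e'}. a e) * (\<Prod>j<m. y j ^ e' j))"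
    if y: "y \<in> trit_cube m" for y
  proof -
    have "y i * f y = (\<Sum>e\<in>reduced_exponents m d. a e * (y i * (\<Prod>j<m. y j ^ e j)))"
      unfolding a[OF y] by (simp add: sum_distrib_left mult_ac)
    also have "\<dots> = (\<Sum>e\<in>reduced_exponents m d. a e * (\<Prod>j<m. y j ^ h e j))"
      by (intro sum.cong) (auto simp: mon[OF y])
    also have "\<dots> = (\<Sum>e'\<in>reduced_exponents m (Suc d). \<Sum>e\<in>{e \<in> reduced_exponents m d. h e = e'}. a e * (\<Prod>j<m. y j ^ h e j))"
      by (rule sum.group[symmetric]) (use h in auto)
    also have "\<dots> = (\<Sum>e'\<in>reduced_exponents m (Suc d). (\<Sum>e\<in>{e \<in> reduced_exponents m d. h e = e'}. a e) * (\<Prod>j<m. y j ^ e' j))"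
      unfolding sum_distrib_right by (intro sum.cong) auto
    finally show ?thesis .
  qed
  then show ?thesis unfolding trit_poly_def
    by (intro exI[of _ "\<lambda>e'. \<Sum>e\<in>{e \<in> reduced_exponents m d. h e = e'}. a e"] ballI)
qed

lemma trit_poly_const: "trit_poly m 0 (\<lambda>_. c)"
proof -
  let ?e = "\<lambda>i\<in>{..<m}. 0::nat"
  have "reduced_exponents m 0 = {?e}"
  proof (intro equalityI subsetI)
    fix e assume "e \<in> reduced_exponents m 0"
    then have "e \<in> extensional {..<m}" "\<forall>i<m. e i = 0" by (auto simp: reduced_exponents_def PiE_iff)
    then show "e \<in> {?e}" by (auto simp: extensional_def)
  qed (auto simp: reduced_exponents_def)
  then show ?thesis unfolding trit_poly_def by (intro exI[of _ "\<lambda>_. c"]) simp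
qed

lemma trit_poly_prod_affine:
  assumes "finite J"
  shows "trit_poly m (card J) (\<lambda>y. \<Prod>j\<in>J. (c j - (\<Sum>i<m. x i * y i)))"
  using assms
proof (induction J rule: finite_induct)
  case empty
  show ?case using trit_poly_const[of m 1] by simp
next
  case (insert j J)
  let ?F = "\<lambda>y. \<Prod>j\<in>J. (c j - (\<Sum>i<m. x i * y i))"
  have 1: "trit_poly m (Suc (card J)) (\<lambda>y. c j * ?F y)"
    by (rule trit_poly_Suc[OF trit_poly_cmult[OF insert.IH]])
  have "trit_poly m (Suc (card J)) (\<lambda>y. 0 * (c j * ?F y))" by (rule trit_poly_cmult[OF 1])
  then have "trit_poly m (Suc (card J)) (\<lambda>y. \<Sum>i<m. (- x i) * (y i * ?F y))"
    by (intro trit_poly_sum trit_poly_cmult[OF trit_poly_var[OF insert.IH]]) auto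
  from trit_poly_add[OF 1 this]
  have "trit_poly m (Suc (card J)) (\<lambda>y. c j * ?F y + (\<Sum>i<m. (- x i) * (y i * ?F y)))" .
  also have "(\<lambda>y. c j * ?F y + (\<Sum>i<m. (- x i) * (y i * ?F y))) = (\<lambda>y. \<Prod>j\<in>insert j J. (c j - (\<Sum>i<m. x i * y i)))"
    using insert.hyps by (simp add: left_diff_distrib sum_distrib_right sum_negf mult.assoc)
  finally show ?case using insert.hyps by simp
qed

text \<open>As \<open>t <= 1\<close>, each counted exponent vector has
  \<open>t ^ d <= t ^ sum e {..<m}\<close>; the generating function over all vectors
  factorises.\<close>

lemma card_reduced_exponents:
  fixes t :: real
  assumes "0 < t" "t \<le> 1"
  shows "real (card (reduced_exponents m d)) * t ^ d \<le> (1 + t + t\<^sup>2) ^ m"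
proof -
  have "real (card (reduced_exponents m d)) * t ^ d = (\<Sum>e\<in>reduced_exponents m d. t ^ d)" by simp
  also have "\<dots> \<le> (\<Sum>e\<in>reduced_exponents m d. t ^ sum e {..<m})"
    using assms by (intro sum_mono power_decreasing) (auto simp: reduced_exponents_def)
  also have "\<dots> \<le> (\<Sum>e\<in>{..<m} \<rightarrow>\<^sub>E {..2}. t ^ sum e {..<m})"
    using assms by (intro sum_mono2 finite_PiE) (auto simp: reduced_exponents_def)
  also have "\<dots> = (\<Sum>e\<in>{..<m} \<rightarrow>\<^sub>E {..2}. \<Prod>i<m. t ^ e i)"
    by (simp add: power_sum)
  also have "\<dots> = (\<Prod>i<m. \<Sum>j\<le>2. t ^ j)"
    by (rule prod_sum_PiE[symmetric]) auto
  also have "\<dots> = (1 + t + t\<^sup>2) ^ m"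
    by (simp add: eval_nat_numeral add.assoc)
  finally show ?thesis .
qed

section \<open>Vectors of a given type and the Frankl-Wilson bound\<close>

definition trits :: "nat \<Rightarrow> nat \<Rightarrow> nat \<Rightarrow> (nat \<Rightarrow> int) set" where
  "trits m a b = {y \<in> trit_cube m. card ({..<m} \<inter> {i. y i = 1}) = a \<and> card ({..<m} \<inter> {i. y i = -1}) = b}"

lemma trits_subset: "trits m a b \<subseteq> trit_cube m"
  by (auto simp: trits_def)

lemma finite_trits [simp]: "finite (trits m a b)"
  by (rule finite_subset[OF trits_subset]) simp

lemma trit_cube_values: "y \<in> trit_cube m \<Longrightarrow> i < m \<Longrightarrow> y i = -1 \<or> y i = 0 \<or> y i = 1"
  by (auto simp: trit_cube_def PiE_iff)

lemma trits_sum_squares: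
  assumes "y \<in> trits m a b"
  shows "(\<Sum>i<m. (y i)\<^sup>2) = int (a + b)"
proof -
  have "(\<Sum>i<m. (y i)\<^sup>2) = (\<Sum>i<m. of_bool (y i = 1) + of_bool (y i = -1))"
    using assms trit_cube_values[of y m] trits_subset[of m a b]
    by (intro sum.cong) (force simp: of_bool_def)+
  also have "\<dots> = int (a + b)"
    using assms by (simp add: sum.distrib sum_of_bool_eq trits_def)
  finally show ?thesis .
qed

lemma trits_sq_dist:
  assumes "x \<in> trits m a b" "y \<in> trits m a b"
  shows "(\<Sum>i<m. (x i - y i)\<^sup>2) = 2 * (int (a + b) - (\<Sum>i<m. x i * y i))"
proof -
  have "(\<Sum>i<m. (x i - y i)\<^sup>2) = (\<Sum>i<m. (x i)\<^sup>2 + (y i)\<^sup>2 - 2 * (x i * y i))"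
    by (intro sum.cong) (auto simp: power2_eq_square algebra_simps)
  also have "\<dots> = (\<Sum>i<m. (x i)\<^sup>2) + (\<Sum>i<m. (y i)\<^sup>2) - 2 * (\<Sum>i<m. x i * y i)"
    by (simp only: sum.distrib sum_subtractf sum_distrib_left)
  finally show ?thesis using assms trits_sum_squares by simp
qed

text \<open>A coordinate product can be -1 only where one of the two entries is -1, which happens at
  most \<open>2 * b\<close> times. Thus half the squared distance is at most
  \<open>a + 3 * b\<close>.\<close>

lemma trits_inner_lower:
  assumes "x \<in> trits m a b" "y \<in> trits m a b"
  shows "int (a + b) - (\<Sum>i<m. x i * y i) \<le> int (a + 3 * b)"
proof -
  have "- (\<Sum>i<m. x i * y i) = (\<Sum>i<m. - (x i * y i))" by (simp add: sum_negf)
  also have "\<dots> \<le> (\<Sum>i<m. of_bool (x i = -1) + of_bool (y i = -1))"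
  proof (rule sum_mono)
    fix i assume "i \<in> {..<m}"
    then have "x i = -1 \<or> x i = 0 \<or> x i = 1" "y i = -1 \<or> y i = 0 \<or> y i = 1"
      using assms trits_subset[of m a b] trit_cube_values[of _ m i] by blast+
    then show "- (x i * y i) \<le> of_bool (x i = -1) + of_bool (y i = -1)" by auto
  qed
  also have "\<dots> = int (2 * b)"
    using assms by (simp add: sum.distrib sum_of_bool_eq trits_def)
  finally show ?thesis by simp
qed

lemma trits_sq_dist_pos:
  assumes "x \<in> trit_cube m" "y \<in> trit_cube m" "x \<noteq> y"
  shows "0 < (\<Sum>i<m. (x i - y i)\<^sup>2)"
proof -
  obtain i where i: "i < m" "x i \<noteq> y i"
    using assms PiE_ext[of x "{..<m}" _ y] unfolding trit_cube_def by blast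
  have "0 < (x i - y i)\<^sup>2" using i by simp
  also have "\<dots> \<le> (\<Sum>i<m. (x i - y i)\<^sup>2)"
    using i by (intro member_le_sum) auto
  finally show ?thesis .
qed

text \<open>The product of \<open>u - j\<close> over \<open>1 \<le> j < q\<close>, a polynomial in half the squared distance \<open>u\<close>, is after
  division by \<open>(q - 1)!\<close> a unit modulo \<open>p\<close> at \<open>u = 0\<close> and vanishes modulo \<open>p\<close> at all other admissible \<open>u\<close>.\<close>

theorem card_trits_avoiding_distance_le:
  assumes A: "A \<subseteq> trits m a b" and q: "primepow q" "a + 3 * b < 2 * q"
    and avoid: "\<And>x y. x \<in> A \<Longrightarrow> y \<in> A \<Longrightarrow> (\<Sum>i<m. (x i - y i)\<^sup>2) \<noteq> 2 * int q"
  shows "card A \<le> card (reduced_exponents m (q - 1))"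
proof (rule ccontr)
  assume "\<not> ?thesis"
  then have lt: "card (reduced_exponents m (q - 1)) < card A" by simp
  have fA: "finite A" using A finite_trits finite_subset by blast
  obtain p k where p: "prime p" "0 < k" "q = p ^ k" using q(1) unfolding primepow_def by blast
  define u where "u x y = int (a + b) - (\<Sum>i<m. x i * y i)" for x y :: "nat \<Rightarrow> int"
  define F where "F x y = (\<Prod>j\<in>{1..<q}. u x y - int j)" for x y
  have "trit_poly m (q - 1) (F x)" for x
  proof -
    have "F x = (\<lambda>y. \<Prod>j\<in>{1..<q}. (int (a + b) - int j - (\<Sum>i<m. x i * y i)))"
      by (auto simp: F_def u_def algebra_simps)
    then show ?thesis using trit_poly_prod_affine[of "{1..<q}" m "\<lambda>j. int (a + b) - int j" x] by simp
  qed
  then obtain g where g: "\<And>x y. y \<in> trit_cube m \<Longrightarrow> F x y = (\<Sum>e\<in>reduced_exponents m (q - 1). g x e * (\<Prod>i<m. y i ^ e i))"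
    unfolding trit_poly_def by metis
  \<comment> \<open>There are more functions \<open>F x\<close> than reduced monomials, so they
    satisfy an integer relation with a coefficient prime to \<open>p\<close>.\<close>
  obtain c where c: "\<exists>x\<in>A. \<not> int p dvd c x" "\<And>e. e \<in> reduced_exponents m (q - 1) \<Longrightarrow> (\<Sum>x\<in>A. c x * g x e) = 0"
    using integer_dependency_not_all_dvd[OF finite_reduced_exponents fA lt, of "int p" g] prime_gt_1_nat[OF p(1)] by auto
  then obtain x0 where x0: "x0 \<in> A" "\<not> int p dvd c x0" by blast
  have cube: "x \<in> trit_cube m" if "x \<in> A" for x using that A trits_subset by blast
  \<comment> \<open>The relation is evaluated at \<open>x0\<close>: every term with \<open>x\<close>
    different from \<open>x0\<close> is divisible by \<open>p * (q - 1)!\<close>, while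
    \<open>F x0 x0\<close> is \<open>(q - 1)!\<close> up to sign.\<close>
  have "(\<Sum>x\<in>A. c x * F x x0) = (\<Sum>x\<in>A. \<Sum>e\<in>reduced_exponents m (q - 1). (\<Prod>i<m. x0 i ^ e i) * (c x * g x e))"
    unfolding g[OF cube[OF x0(1)]] by (simp add: sum_distrib_left mult_ac)
  also have "\<dots> = (\<Sum>e\<in>reduced_exponents m (q - 1). (\<Prod>i<m. x0 i ^ e i) * (\<Sum>x\<in>A. c x * g x e))"
    by (subst sum.swap) (simp add: sum_distrib_left)
  also have "\<dots> = 0" using c(2) by simp
  finally have "c x0 * F x0 x0 = - (\<Sum>x\<in>A - {x0}. c x * F x x0)"
    using sum.remove[OF fA x0(1), of "\<lambda>x. c x * F x x0"] by simp
  moreover have "int p * fact (q - 1) dvd (\<Sum>x\<in>A - {x0}. c x * F x x0)"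
  proof (rule dvd_sum)
    fix x assume x: "x \<in> A - {x0}"
    have s: "(\<Sum>i<m. (x i - x0 i)\<^sup>2) = 2 * u x x0"
      unfolding u_def using x x0 A by (intro trits_sq_dist[of _ _ a b]) auto
    have "0 < u x x0" using trits_sq_dist_pos[of x m x0] x x0 cube s by auto
    moreover have "u x x0 \<le> int (a + 3 * b)" unfolding u_def using x x0 A by (intro trits_inner_lower) auto
    moreover have "u x x0 \<noteq> int q" using avoid[of x x0] x x0 s by auto
    ultimately have "int p * fact (q - 1) dvd F x x0" unfolding F_def
      using q(2) by (intro prime_dvd_prod_prime_power[OF p]) auto
    then show "int p * fact (q - 1) dvd c x * F x x0" by (rule dvd_mult)
  qed
  ultimately have "int p * fact (q - 1) dvd c x0 * F x0 x0" by simp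
  moreover have "\<bar>F x0 x0\<bar> = fact (q - 1)"
  proof -
    have "u x0 x0 = 0" unfolding u_def using trits_sum_squares[of x0 m a b] x0 A
      by (auto simp: power2_eq_square)
    then have "\<bar>F x0 x0\<bar> = (\<Prod>j\<in>{1..<q}. int j)" by (simp add: F_def abs_prod)
    also have "{1..<q} = {1..q - 1}" using p by (auto simp: prime_gt_0_nat)
    also have "(\<Prod>j\<in>{1..q - 1}. int j) = fact (q - 1)" by (simp add: fact_prod)
    finally show ?thesis .
  qed
  ultimately have "int p * fact (q - 1) dvd c x0 * fact (q - 1)"
    by (metis abs_mult abs_dvd_iff dvd_abs_iff abs_of_nonneg fact_ge_zero)
  then have "int p dvd c x0" by simp
  then show False using x0 by simp
qed

section \<open>A large type, and corners in a product set\<close>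

text \<open>Expanding \<open>(1 + x + x ^ 3) ^ m\<close> over the cube and grouping by type gives
  \<open>(m + 1)^2\<close> summands, so one of them is at least the average.\<close>

lemma exists_large_trits:
  fixes x :: real
  assumes "0 < x"
  shows "\<exists>a\<le>m. \<exists>b\<le>m. (1 + x + x ^ 3) ^ m \<le> (real m + 1)\<^sup>2 * (real (card (trits m a b)) * x ^ (a + 3 * b))"
proof (rule ccontr)
  assume "\<not> ?thesis"
  then have lt: "(real m + 1)\<^sup>2 * (real (card (trits m a b)) * x ^ (a + 3 * b)) < (1 + x + x ^ 3) ^ m" if "a \<le> m" "b \<le> m" for a b
    using that by (meson not_le)
  define w where "w i = (if i = 1 then x else if i = -1 then x ^ 3 else 1)" for i :: int
  define ty where "ty y = (card ({..<m} \<inter> {i. y i = 1}), card ({..<m} \<inter> {i. y i = -1}))" for y :: "nat \<Rightarrow> int"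
  have le: "card ({..<m} \<inter> B) \<le> m" for B
    using card_mono[of "{..<m}" "{..<m} \<inter> B"] by simp
  have W: "(\<Prod>i<m. w (y i)) = x ^ (fst (ty y) + 3 * snd (ty y))" for y
  proof -
    have "(\<Prod>i<m. w (y i)) = (\<Prod>i<m. (if y i = 1 then x else 1) * (if y i = -1 then x ^ 3 else 1))"
      by (intro prod.cong) (auto simp: w_def)
    also have "\<dots> = x ^ card ({..<m} \<inter> {i. y i = 1}) * (x ^ 3) ^ card ({..<m} \<inter> {i. y i = -1})"
      by (simp add: prod.distrib prod.If_cases)
    finally show ?thesis by (simp add: ty_def power_add power_mult)
  qed
  have "(1 + x + x ^ 3) ^ m = (\<Prod>i<m. \<Sum>v\<in>{-1, 0, 1::int}. w v)"
    by (simp add: w_def algebra_simps)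
  also have "\<dots> = (\<Sum>y\<in>trit_cube m. \<Prod>i<m. w (y i))"
    unfolding trit_cube_def by (rule prod_sum_PiE) auto
  also have "\<dots> = (\<Sum>y\<in>trit_cube m. x ^ (fst (ty y) + 3 * snd (ty y)))"
    by (simp only: W)
  also have "\<dots> = (\<Sum>t\<in>{..m} \<times> {..m}. \<Sum>y\<in>{y \<in> trit_cube m. ty y = t}. x ^ (fst (ty y) + 3 * snd (ty y)))"
    by (rule sum.group[symmetric]) (auto simp: ty_def le)
  also have "\<dots> = (\<Sum>t\<in>{..m} \<times> {..m}. real (card (trits m (fst t) (snd t))) * x ^ (fst t + 3 * snd t))"
  proof (rule sum.cong[OF refl])
    fix t
    have "{y \<in> trit_cube m. ty y = t} = trits m (fst t) (snd t)"
      by (auto simp: trits_def ty_def)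
    moreover have "(\<Sum>y\<in>{y \<in> trit_cube m. ty y = t}. x ^ (fst (ty y) + 3 * snd (ty y))) = (\<Sum>y\<in>{y \<in> trit_cube m. ty y = t}. x ^ (fst t + 3 * snd t))"
      by (intro sum.cong) auto
    ultimately show "(\<Sum>y\<in>{y \<in> trit_cube m. ty y = t}. x ^ (fst (ty y) + 3 * snd (ty y))) = real (card (trits m (fst t) (snd t))) * x ^ (fst t + 3 * snd t)"
      by simp
  qed
  also have "\<dots> < (\<Sum>t\<in>{..m} \<times> {..m}. (1 + x + x ^ 3) ^ m / (real m + 1)\<^sup>2)"
    using lt by (intro sum_strict_mono) (auto simp: field_simps)
  also have "\<dots> = real (card ({..m} \<times> {..m})) * ((1 + x + x ^ 3) ^ m / (real m + 1)\<^sup>2)"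
    by (rule sum_constant)
  also have "real (card ({..m} \<times> {..m})) = (real m + 1)\<^sup>2"
    by (simp add: card_cartesian_product power2_eq_square algebra_simps)
  also have "(real m + 1)\<^sup>2 * ((1 + x + x ^ 3) ^ m / (real m + 1)\<^sup>2) = (1 + x + x ^ 3) ^ m"
    by (simp add: add_nonneg_eq_0_iff)
  finally show False by simp
qed

text \<open>In each direction \<open>i\<close>, the points of \<open>A\<close> without an \<open>R\<close>-neighbour along their line form an
  independent set on every line, so there are few of them.\<close>

lemma exists_corner:
  fixes V :: "'a set" and I :: "'i set"
  assumes V: "finite V" and I: "finite I"
    and indep: "\<And>S. S \<subseteq> V \<Longrightarrow> (\<forall>x\<in>S. \<forall>y\<in>S. \<not> R x y) \<Longrightarrow> card S \<le> \<alpha>"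
    and A: "A \<subseteq> I \<rightarrow>\<^sub>E V" "card I * (\<alpha> * card V ^ (card I - 1)) < card A"
  shows "\<exists>x\<in>A. \<forall>i\<in>I. \<exists>y. R (x i) y \<and> x(i := y) \<in> A"
proof (rule ccontr)
  assume neg: "\<not> ?thesis"
  define Bad where "Bad i = {x \<in> A. \<not> (\<exists>y. R (x i) y \<and> x(i := y) \<in> A)}" for i
  have fA: "finite A" using A(1) V I by (auto intro: finite_subset finite_PiE)
  have bad: "card (Bad i) \<le> \<alpha> * card V ^ (card I - 1)" if i: "i \<in> I" for i
  proof -
    let ?P = "(I - {i}) \<rightarrow>\<^sub>E V"
    let ?fib = "\<lambda>r. {x \<in> Bad i. restrict x (I - {i}) = r}"
    have fib: "card (?fib r) \<le> \<alpha>" for r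
    proof -
      \<comment> \<open>Points of one fibre agree on \<open>I - {i}\<close>, and outside
        \<open>I\<close> both are \<open>undefined\<close>.\<close>
      have eq: "y = x(i := y i)" if "x \<in> ?fib r" "y \<in> ?fib r" for x y
      proof
        fix j
        have xy: "x \<in> I \<rightarrow>\<^sub>E V" "y \<in> I \<rightarrow>\<^sub>E V" "restrict x (I - {i}) = restrict y (I - {i})"
          using that A(1) by (auto simp: Bad_def)
        show "y j = (x(i := y i)) j"
        proof (cases "j \<in> I - {i}")
          case True
          then show ?thesis using fun_cong[OF xy(3), of j] by auto
        next
          case False
          then show ?thesis using xy(1,2) by (auto simp: PiE_iff extensional_def)
        qed
      qed
      have "inj_on (\<lambda>x. x i) (?fib r)"
      proof (rule inj_onI)
        fix x y assume xy: "x \<in> ?fib r" "y \<in> ?fib r" "x i = y i"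
        from eq[OF xy(1,2)] show "x = y" unfolding xy(3)[symmetric] by simp
      qed
      then have "card (?fib r) = card ((\<lambda>x. x i) ` ?fib r)" by (simp add: card_image)
      also have "\<dots> \<le> \<alpha>"
      proof (rule indep)
        show "(\<lambda>x. x i) ` ?fib r \<subseteq> V" using A(1) i by (auto simp: Bad_def PiE_iff)
        show "\<forall>x\<in>(\<lambda>x. x i) ` ?fib r. \<forall>y\<in>(\<lambda>x. x i) ` ?fib r. \<not> R x y"
        proof (intro ballI; elim imageE)
          fix v w x y assume xy: "v = x i" "x \<in> ?fib r" "w = y i" "y \<in> ?fib r"
          \<comment> \<open>This point is \<open>y\<close> itself; since \<open>x\<close> is bad,
            its new entry cannot be an \<open>R\<close>-neighbour of \<open>x i\<close>.\<close>
          have "x(i := y i) \<in> A" using eq[OF xy(2,4)] xy(4) by (simp add: Bad_def)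
          then show "\<not> R v w" using xy by (auto simp: Bad_def)
        qed
      qed
      finally show ?thesis .
    qed
    have "Bad i \<subseteq> (\<Union>r\<in>?P. ?fib r)" using A(1) by (auto simp: Bad_def PiE_iff)
    then have "card (Bad i) \<le> card (\<Union>r\<in>?P. ?fib r)"
      using V I fA by (intro card_mono finite_UN_I finite_PiE) (auto simp: Bad_def)
    also have "\<dots> \<le> (\<Sum>r\<in>?P. card (?fib r))"
      using V I by (intro card_UN_le finite_PiE) auto
    also have "\<dots> \<le> card ?P * \<alpha>"
      using sum_bounded_above[of ?P "\<lambda>r. card (?fib r)" \<alpha>] fib by simp
    also have "card ?P = card V ^ (card I - 1)" using I i by (simp add: card_PiE)
    finally show ?thesis by (simp add: mult.commute)
  qed
  have "A \<subseteq> (\<Union>i\<in>I. Bad i)" using neg by (auto simp: Bad_def)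
  then have "card A \<le> card (\<Union>i\<in>I. Bad i)"
    using I fA by (intro card_mono finite_UN_I) (auto simp: Bad_def)
  also have "\<dots> \<le> (\<Sum>i\<in>I. card (Bad i))" by (rule card_UN_le[OF I])
  also have "\<dots> \<le> card I * (\<alpha> * card V ^ (card I - 1))"
    using sum_bounded_above[of I "\<lambda>i. card (Bad i)"] bad by simp
  finally show False using A(2) by simp
qed

section \<open>Embedding into Euclidean space\<close>

definition block_embedding :: "nat \<Rightarrow> nat \<Rightarrow> real \<Rightarrow> (nat \<Rightarrow> nat \<Rightarrow> int) \<Rightarrow> nat \<Rightarrow> real" where
  "block_embedding N m s x j = (if j < N * m then s * of_int (x (j div m) (j mod m)) else 0)"

lemma block_embedding_in_Rn:
  assumes "N * m \<le> n"
  shows "block_embedding N m s x \<in> Rn n"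
  using assms by (auto simp: block_embedding_def topspace_Euclidean_space)

lemma edist_block_embedding:
  assumes "N * m \<le> n"
  shows "(edist n (block_embedding N m s x) (block_embedding N m s y))\<^sup>2
    = s\<^sup>2 * of_int (\<Sum>l<N. \<Sum>i<m. (x l i - y l i)\<^sup>2)"
proof -
  let ?D = "\<lambda>j. s\<^sup>2 * of_int ((x (j div m) (j mod m) - y (j div m) (j mod m))\<^sup>2) :: real"
  have "(edist n (block_embedding N m s x) (block_embedding N m s y))\<^sup>2
      = (\<Sum>j<n. (block_embedding N m s x j - block_embedding N m s y j)\<^sup>2)"
    by (simp add: edist_def L2_set_def sum_nonneg)
  also have "\<dots> = (\<Sum>j<N * m. ?D j)"
    using assms by (intro sum.mono_neutral_cong_right)
      (auto simp: block_embedding_def right_diff_distrib[symmetric] power_mult_distrib)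
  also have "\<dots> = (\<Sum>l<N. sum ?D {l * m..<l * m + m})"
    by (rule sum.nat_group[symmetric])
  also have "\<dots> = (\<Sum>l<N. \<Sum>i<m. s\<^sup>2 * of_int ((x l i - y l i)\<^sup>2))"
  proof (rule sum.cong[OF refl])
    fix l
    have "sum ?D {l * m..<l * m + m} = (\<Sum>i<m. ?D (l * m + i))"
      using sum.atLeastLessThan_shift_0[of ?D "l * m" "l * m + m"] by (simp add: lessThan_atLeast0 o_def)
    also have "\<dots> = (\<Sum>i<m. s\<^sup>2 * of_int ((x l i - y l i)\<^sup>2))"
      by (intro sum.cong) auto
    finally show "sum ?D {l * m..<l * m + m} = (\<Sum>i<m. s\<^sup>2 * of_int ((x l i - y l i)\<^sup>2))" .
  qed
  finally show ?thesis by (simp add: sum_distrib_left)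
qed

lemma edist_nonneg: "0 \<le> edist n x y"
  by (simp add: edist_def)

lemma edist_self [simp]: "edist n x x = 0"
  by (simp add: edist_def L2_set_def)

text \<open>All distances between distinct points are 1 on both sides, so any bijection is an
  isometry.\<close>

lemma isometric_copy_unit_simplex:
  assumes M: "unit_regular_simplex k d M"
    and z: "\<And>i. i \<le> k \<Longrightarrow> z i \<in> Rn n"
    and dist: "\<And>i j. i \<le> k \<Longrightarrow> j \<le> k \<Longrightarrow> i \<noteq> j \<Longrightarrow> edist n (z i) (z j) = 1"
  shows "isometric_copy d M n (z ` {..k})"
proof -
  have "finite M" "card M = card {..k}"
    using M card_ge_0_finite[of M] by (auto simp: unit_regular_simplex_def)
  then obtain h where h: "bij_betw h M {..k}"
    using finite_same_card_bij[of M "{..k}"] by auto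
  have "inj_on z {..k}"
  proof (rule inj_onI, rule ccontr)
    fix i j assume "i \<in> {..k}" "j \<in> {..k}" "z i = z j" "i \<noteq> j"
    then show False using dist[of i j] by simp
  qed
  then have "bij_betw (z \<circ> h) M (z ` {..k})"
    by (intro bij_betw_trans[OF h]) (auto simp: bij_betw_def)
  moreover have "edist n ((z \<circ> h) v) ((z \<circ> h) w) = edist d v w" if "v \<in> M" "w \<in> M" for v w
  proof (cases "v = w")
    case False
    then have "h v \<le> k" "h w \<le> k" "h v \<noteq> h w"
      using h that by (auto simp: bij_betw_def inj_on_def)
    moreover have "edist d v w = 1" using M that False by (auto simp: unit_regular_simplex_def pairwise_def)
    ultimately show ?thesis using dist by simp
  qed simp
  ultimately show ?thesis using z unfolding isometric_copy_def by (intro conjI exI[of _ "z \<circ> h"]) auto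
qed

section \<open>Lower bounds for the chromatic number and growth rates\<close>

lemma chromatic_number_ge:
  assumes "\<And>r c. proper_coloring n d M r c \<Longrightarrow> t \<le> real r"
  shows "ereal t \<le> ereal_of_enat (chromatic_number n d M)"
proof (cases "{enat r |r. \<exists>c. proper_coloring n d M r c} = {}")
  case True
  then have "chromatic_number n d M = \<infinity>" unfolding chromatic_number_def True by (simp add: Inf_enat_def)
  then show ?thesis by simp
next
  case False
  let ?X = "{enat r |r. \<exists>c. proper_coloring n d M r c}"
  have "chromatic_number n d M = (LEAST x. x \<in> ?X)"
    unfolding chromatic_number_def Inf_enat_def by (simp only: False if_False)
  also have "\<dots> \<in> ?X" using False by (meson LeastI ex_in_conv)
  finally show ?thesis using assms by auto
qed

text \<open>It suffices to beat every smaller base eventually; the error term is the deviation of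
  the \<open>n\<close>-th root from \<open>a\<close>.\<close>

lemma exp_lower_boundI:
  assumes a: "0 < a"
    and le: "\<And>\<gamma>. 0 < \<gamma> \<Longrightarrow> \<gamma> < a \<Longrightarrow> \<forall>\<^sub>F n in sequentially. ereal (\<gamma> ^ n) \<le> ereal_of_enat (f n)"
  shows "exp_lower_bound f a"
proof -
  \<comment> \<open>Capping at \<open>a\<close> makes the roots converge to \<open>a\<close> even if
    \<open>f\<close> grows faster or is infinite.\<close>
  define g where "g n = (if f n = \<infinity> then a else min a (root n (real (the_enat (f n)))))" for n
  have "g \<longlonglongrightarrow> a"
  proof (rule order_tendstoI)
    fix y assume y: "y < a"
    define \<gamma> where "\<gamma> = (max y 0 + a) / 2"
    have \<gamma>: "0 < \<gamma>" "\<gamma> < a" "y < \<gamma>" using a y by (auto simp: \<gamma>_def max_def)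
    show "\<forall>\<^sub>F n in sequentially. y < g n"
      using le[OF \<gamma>(1,2)] eventually_gt_at_top[of 0]
    proof eventually_elim
      case (elim n)
      show ?case
      proof (cases "f n")
        case (enat N)
        then have "\<gamma> ^ n \<le> real N" using elim(1) by simp
        then have "root n (\<gamma> ^ n) \<le> root n (real N)" using elim(2) by simp
        then have "\<gamma> \<le> root n (real N)" using \<gamma>(1) elim(2) by (simp add: real_root_power_cancel)
        then show ?thesis using enat \<gamma> by (simp add: g_def)
      qed (use y in \<open>simp add: g_def\<close>)
    qed
  next
    fix y assume "a < y"
    then show "\<forall>\<^sub>F n in sequentially. g n < y"
      by (intro always_eventually) (auto simp: g_def)
  qed
  then have "(\<lambda>n. g n - a) \<longlonglongrightarrow> 0" using tendsto_diff[OF _ tendsto_const[of a]] by fastforce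
  then have "(\<lambda>n. g n - a) \<in> o(\<lambda>_. 1)" by (intro smalloI_tendsto) auto
  moreover have "\<forall>\<^sub>F n in sequentially. ereal ((a + (g n - a)) ^ n) \<le> ereal_of_enat (f n)"
    using eventually_gt_at_top[of 0]
  proof eventually_elim
    case (elim n)
    show ?case
    proof (cases "f n")
      case (enat N)
      have "0 \<le> g n" "g n \<le> root n (real N)" using enat a real_root_ge_zero[of "real N" n] by (auto simp: g_def)
      then have "g n ^ n \<le> root n (real N) ^ n" by (intro power_mono)
      also have "\<dots> = real N" using elim by (intro real_root_pow_pos2) auto
      finally show ?thesis using enat by simp
    qed simp
  qed
  ultimately show ?thesis unfolding exp_lower_bound_def by blast
qed

section \<open>Numerical bounds for \<open>psi2\<close>\<close>

text \<open>A sum-of-squares certificate: \<open>?u\<close> matches the cubic coefficient,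
  \<open>?B\<close> the quadratic one, and completing the square in \<open>x\<close> leaves a
  nonnegative constant. The bound lies below \<open>1.0743 ^ 3\<close> and
  \<open>1.0552 ^ 4\<close>.\<close>

lemma psi2_function_le:
  fixes x :: real
  shows "(1 + x + x ^ 3) / (1 + x\<^sup>2 + x ^ 4) \<le> 1.2397"
proof -
  \<comment> \<open>\<open>?w\<close> makes the first square below nearly vanish at the maximiser \<open>x = 0.464...\<close>\<close>
  let ?c = "1.2397 :: real" and ?w = "0.0281 :: real"
  let ?u = "1 / (2 * ?c)"
  let ?B = "?c - ?c * (?u\<^sup>2 - 2 * ?w)"
  have "?c * (1 + x\<^sup>2 + x ^ 4) - (1 + x + x ^ 3)
     = ?c * (x\<^sup>2 - ?u * x - ?w)\<^sup>2 + ?B * (x - (1 + ?w) / (2 * ?B))\<^sup>2 + (?c - 1 - ?c * ?w\<^sup>2 - (1 + ?w)\<^sup>2 / (4 * ?B))"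
    by (simp add: power2_eq_square power3_eq_cube power4_eq_xxxx field_simps)
  moreover have "0 \<le> ?c - 1 - ?c * ?w\<^sup>2 - (1 + ?w)\<^sup>2 / (4 * ?B)"
    by (simp add: power2_eq_square)
  moreover have "0 \<le> ?B" "0 \<le> ?c" by (simp_all add: power2_eq_square)
  ultimately have "0 \<le> ?c * (1 + x\<^sup>2 + x ^ 4) - (1 + x + x ^ 3)"
    by (simp only: add_nonneg_nonneg mult_nonneg_nonneg zero_le_power2) 
  then have "1 + x + x ^ 3 \<le> ?c * (1 + x\<^sup>2 + x ^ 4)" by (simp only: diff_ge_0_iff_ge)
  moreover have "0 < 1 + x\<^sup>2 + x ^ 4" by (simp add: add_pos_nonneg)
  ultimately show ?thesis by (simp add: pos_divide_le_eq)
qed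

lemma bdd_above_psi2_function:
  "bdd_above ((\<lambda>x::real. (1 + x + x ^ 3) / (1 + x\<^sup>2 + x ^ 4)) ` A)"
  by (rule bdd_aboveI2[OF psi2_function_le])

lemma psi2_ge:
  assumes "x \<in> {0..1}"
  shows "(1 + x + x ^ 3) / (1 + x\<^sup>2 + x ^ 4) \<le> psi2"
  unfolding psi2_def by (rule cSUP_upper[OF assms bdd_above_psi2_function])

lemma psi2_le: "psi2 \<le> 1.2397"
  unfolding psi2_def by (rule cSUP_least[OF _ psi2_function_le]) auto

text \<open>The point 0.464 is close to the maximiser. The bound also exceeds 1.239 and
  \<open>1.0551 ^ 4\<close>.\<close>

lemma psi2_lower: "1.0742 ^ 3 \<le> psi2"
  by (rule order_trans[OF _ psi2_ge[of "0.464"]]) (simp_all add: eval_nat_numeral)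

text \<open>The quotient is 1 at both endpoints and \<open>psi2 > 1\<close>, so a near-maximiser
  lies strictly inside.\<close>

lemma psi2_approx:
  assumes "\<beta> < psi2"
  obtains x where "0 < x" "x < 1" "\<beta> < (1 + x + x ^ 3) / (1 + x\<^sup>2 + x ^ 4)"
proof -
  have "max \<beta> 1 < psi2" using assms psi2_lower by (simp add: eval_nat_numeral)
  then obtain x where x: "x \<in> {0..1}" "max \<beta> 1 < (1 + x + x ^ 3) / (1 + x\<^sup>2 + x ^ 4)"
    unfolding psi2_def by (subst (asm) less_cSUP_iff) (auto intro: bdd_above_psi2_function)
  then have "x \<noteq> 0" "x \<noteq> 1" by auto
  then show ?thesis using x that[of x] by auto
qed

section \<open>The lower bound\<close>

text \<open>A colour class with more than \<open>(k + 1) * \<alpha> * |V| ^ k\<close> of the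
  \<open>|V| ^ (k + 1)\<close> points would contain a corner, hence a monochromatic simplex.\<close>

lemma proper_coloring_card_le:
  assumes V: "V \<subseteq> trit_cube m" and q: "0 < q"
    and indep: "\<And>S. S \<subseteq> V \<Longrightarrow> (\<And>x y. x \<in> S \<Longrightarrow> y \<in> S \<Longrightarrow> (\<Sum>i<m. (x i - y i)\<^sup>2) \<noteq> 2 * int q) \<Longrightarrow> card S \<le> \<alpha>"
    and M: "unit_regular_simplex k d M" and n: "Suc k * m \<le> n"
    and col: "proper_coloring n d M r c"
  shows "card V \<le> r * (Suc k * \<alpha>)"
proof -
  have fV: "finite V" using V finite_trit_cube finite_subset by blast
  define P where "P = {..k} \<rightarrow>\<^sub>E V"
  have fP: "finite P" unfolding P_def using fV by (intro finite_PiE) auto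
  \<comment> \<open>Scales squared distance \<open>4 * q\<close>, that is \<open>2 * q\<close> in
    each of two blocks, to 1.\<close>
  define s where "s = 1 / sqrt (4 * real q)"
  have s: "s\<^sup>2 * (4 * real q) = 1" using q by (simp add: s_def power_divide)
  define emb where "emb = block_embedding (Suc k) m s"
  define A where "A j = {x \<in> P. c (emb x) = j}" for j
  have small: "card (A j) \<le> Suc k * (\<alpha> * card V ^ k)" for j
  proof (rule ccontr)
    assume "\<not> ?thesis"
    then have "card {..k} * (\<alpha> * card V ^ (card {..k} - 1)) < card (A j)" by simp
    then obtain x where x: "x \<in> A j" "\<forall>i\<in>{..k}. \<exists>y. (\<Sum>l<m. (x i l - y l)\<^sup>2) = 2 * int q \<and> x(i := y) \<in> A j"
      using exists_corner[of V "{..k}" "\<lambda>x y. (\<Sum>l<m. (x l - y l)\<^sup>2) = 2 * int q" \<alpha> "A j"] fV indep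
      by (auto simp: A_def P_def)
    then obtain y where y: "\<And>i. i \<le> k \<Longrightarrow> (\<Sum>l<m. (x i l - y i l)\<^sup>2) = 2 * int q"
      "\<And>i. i \<le> k \<Longrightarrow> x(i := y i) \<in> A j" by (metis atMost_iff)
    define z where "z i = emb (x(i := y i))" for i
    have "edist n (z i) (z i') = 1" if i: "i \<le> k" "i' \<le> k" "i \<noteq> i'" for i i'
    proof -
      have "(\<Sum>l<Suc k. \<Sum>h<m. ((x(i := y i)) l h - (x(i' := y i')) l h)\<^sup>2)
         = (\<Sum>l<Suc k. (if l = i then 2 * int q else 0) + (if l = i' then 2 * int q else 0))"
      proof (rule sum.cong[OF refl])
        fix l assume "l \<in> {..<Suc k}"
        show "(\<Sum>h<m. ((x(i := y i)) l h - (x(i' := y i')) l h)\<^sup>2)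
          = (if l = i then 2 * int q else 0) + (if l = i' then 2 * int q else 0)"
          using y(1)[OF i(1)] y(1)[OF i(2)] i(3) by (auto simp: power2_commute)
      qed
      also have "\<dots> = 4 * int q"
        using i by (simp only: sum.distrib sum.delta finite_lessThan lessThan_iff) simp
      finally have "(edist n (z i) (z i'))\<^sup>2 = s\<^sup>2 * (4 * real q)"
        unfolding z_def emb_def edist_block_embedding[OF n] by simp
      then have "(edist n (z i) (z i'))\<^sup>2 = 1\<^sup>2" using s by simp
      then show ?thesis by (rule power2_eq_imp_eq) (auto simp: edist_nonneg)
    qed
    then have "isometric_copy d M n (z ` {..k})"
      using block_embedding_in_Rn[OF n] by (intro isometric_copy_unit_simplex[OF M]) (auto simp: z_def emb_def)
    moreover have "\<forall>v\<in>z ` {..k}. c v = j" using y(2) by (auto simp: z_def A_def)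
    ultimately show False using col unfolding proper_coloring_def by blast
  qed
  have "c (emb x) < r" for x
    using col block_embedding_in_Rn[OF n] unfolding proper_coloring_def emb_def by blast
  then have "P \<subseteq> (\<Union>j<r. A j)" by (auto simp: A_def)
  then have "card P \<le> card (\<Union>j<r. A j)"
    using fP by (intro card_mono finite_UN_I) (auto simp: A_def)
  also have "\<dots> \<le> (\<Sum>j<r. card (A j))" by (rule card_UN_le) simp
  also have "\<dots> \<le> r * (Suc k * (\<alpha> * card V ^ k))"
    using sum_bounded_above[of "{..<r}" "\<lambda>j. card (A j)"] small by simp
  also have "card P = card V * card V ^ k" by (simp add: P_def card_PiE)
  finally have "card V ^ k * card V \<le> card V ^ k * (r * (Suc k * \<alpha>))" by (simp add: algebra_simps)
  then show ?thesis by (cases "card V = 0") auto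
qed

text \<open>The expression is the square of \<open>m * t ^ m + t ^ m\<close> with
  \<open>t = sqrt \<rho>\<close>.\<close>

lemma polynomial_times_power_tendsto_0:
  fixes \<rho> :: real
  assumes "0 \<le> \<rho>" "\<rho> < 1"
  shows "(\<lambda>m. (real m + 1)\<^sup>2 * \<rho> ^ m) \<longlonglongrightarrow> 0"
proof -
  define t where "t = sqrt \<rho>"
  have t: "norm t < 1" "\<rho> = t\<^sup>2" using assms by (auto simp: t_def)
  have "(\<lambda>m. (of_nat m * t ^ m + t ^ m)\<^sup>2) \<longlonglongrightarrow> (0 + 0)\<^sup>2"
    by (intro tendsto_intros powser_times_n_limit_0 LIMSEQ_power_zero t(1))
  moreover have "(of_nat m * t ^ m + t ^ m)\<^sup>2 = (real m + 1)\<^sup>2 * \<rho> ^ m" for m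
  proof -
    have "of_nat m * t ^ m + t ^ m = (real m + 1) * t ^ m" by (simp add: distrib_right)
    moreover have "(t ^ m)\<^sup>2 = \<rho> ^ m" unfolding t(2) by (simp only: power_mult[symmetric] mult.commute)
    ultimately show ?thesis by (simp only: power_mult_distrib)
  qed
  ultimately show ?thesis by (simp only: add_0_left power_zero_numeral)
qed

text \<open>Shifting \<open>L / 2\<close> by the threshold \<open>X'\<close> covers all
  \<open>L\<close>, small ones included, at the cost of the constant \<open>C\<close>.\<close>

lemma exists_suitable_primepow:
  assumes "0 < (\<epsilon>::real)"
  obtains C where "0 \<le> C" "\<And>L::nat. \<exists>q. primepow q \<and> L < 2 * q \<and> 2 * real q \<le> (1 + \<epsilon>) * real L + C"
proof -
  obtain X where X: "\<And>x. X \<le> x \<Longrightarrow> \<exists>q. primepow q \<and> x < real q \<and> real q \<le> (1 + \<epsilon>) * x"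
    using primepow_between[OF assms] unfolding eventually_at_top_linorder by blast
  define X' where "X' = max X 0"
  have "\<exists>q. primepow q \<and> L < 2 * q \<and> 2 * real q \<le> (1 + \<epsilon>) * real L + 2 * (1 + \<epsilon>) * X'" for L :: nat
  proof -
    have "X \<le> X'" by (simp add: X'_def)
    then have "X \<le> real L / 2 + X'" by (simp add: add_increasing)
    from X[OF this] obtain q where q: "primepow q" "real L / 2 + X' < real q" "real q \<le> (1 + \<epsilon>) * (real L / 2 + X')"
      by blast
    have "0 \<le> X'" by (simp add: X'_def)
    then have "real L < 2 * real q" using q(2) by linarith
    then have "L < 2 * q" by linarith
    moreover have "2 * real q \<le> (1 + \<epsilon>) * real L + 2 * (1 + \<epsilon>) * X'"
    proof -
      have "2 * ((1 + \<epsilon>) * (real L / 2 + X')) = (1 + \<epsilon>) * real L + 2 * (1 + \<epsilon>) * X'"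
        by (simp add: field_simps)
      then show ?thesis using q(3) by linarith
    qed
    ultimately show ?thesis using q(1) by blast
  qed
  then show ?thesis using assms by (intro that[of "2 * (1 + \<epsilon>) * X'"]) (auto simp: X'_def)
qed

text \<open>Combines a large type, a prime power just above \<open>(a + 3 * b) / 2\<close> and the
  independence bound. The factor \<open>K\<close> leaves room for dimensions not divisible by
  \<open>k + 1\<close>.\<close>

lemma proper_coloring_growth:
  assumes M: "unit_regular_simplex k d M" and \<beta>: "0 < \<beta>" "\<beta> < psi2" and K: "0 < K"
  shows "\<forall>\<^sub>F m in sequentially. \<forall>n r c. Suc k * m \<le> n \<longrightarrow> proper_coloring n d M r c \<longrightarrow> K * \<beta> ^ m \<le> real r"
proof -
  obtain x where x: "0 < x" "x < 1" and \<psi>: "\<beta> < (1 + x + x ^ 3) / (1 + x\<^sup>2 + x ^ 4)"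
    using psi2_approx[OF \<beta>(2)] .
  define \<psi> where "\<psi> = (1 + x + x ^ 3) / (1 + x\<^sup>2 + x ^ 4)"
  have \<psi>0: "0 < \<psi>" using \<beta> \<psi> by (simp add: \<psi>_def)
  \<comment> \<open>Since \<open>a + 3 * b <= 4 * m\<close>, a prime power too large by the factor
    \<open>1 + \<epsilon>\<close> costs at most \<open>x powr (4 * \<epsilon> * m)\<close>; this
    must not push the base down to \<open>\<beta>\<close>.\<close>
  have "((\<lambda>\<epsilon>. \<psi> * x powr (4 * \<epsilon>)) \<longlongrightarrow> \<psi> * x powr (4 * 0)) (at_right 0)"
    using x by (intro tendsto_intros) auto
  then have "\<forall>\<^sub>F \<epsilon> in at_right 0. \<beta> < \<psi> * x powr (4 * \<epsilon>)"
    using x \<psi> by (intro order_tendstoD(1)) (auto simp: \<psi>_def)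
  moreover have "\<forall>\<^sub>F \<epsilon> in at_right (0::real). 0 < \<epsilon>" by (rule eventually_at_right_less)
  ultimately obtain \<epsilon> where \<epsilon>: "0 < \<epsilon>" "\<beta> < \<psi> * x powr (4 * \<epsilon>)"
    using eventually_happens'[OF trivial_limit_at_right_real eventually_conj] by blast
  define \<beta>' where "\<beta>' = \<psi> * x powr (4 * \<epsilon>)"
  obtain C where C: "0 \<le> C" "\<And>L::nat. \<exists>q. primepow q \<and> L < 2 * q \<and> 2 * real q \<le> (1 + \<epsilon>) * real L + C"
    using exists_suitable_primepow[OF \<epsilon>(1)] by blast
  \<comment> \<open>Gathers the constants: the claim follows from \<open>bound\<close> once
    \<open>E * (m + 1)^2 * (\<beta> / \<beta>') ^ m < 1\<close>.\<close>
  define E where "E = K * (real k + 1) / x powr C"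
  have E: "0 < E" using K x by (simp add: E_def)
  have bound: "\<beta>' ^ m * x powr C \<le> (real m + 1)\<^sup>2 * ((real k + 1) * real r)"
    if n: "Suc k * m \<le> n" and col: "proper_coloring n d M r c" for m n r c
  proof -
    obtain a b where ab: "a \<le> m" "b \<le> m"
      "(1 + x + x ^ 3) ^ m \<le> (real m + 1)\<^sup>2 * (real (card (trits m a b)) * x ^ (a + 3 * b))"
      using exists_large_trits[OF x(1), of m] by blast
    define L where "L = a + 3 * b"
    obtain q where q: "primepow q" "L < 2 * q" "2 * real q \<le> (1 + \<epsilon>) * real L + C"
      using C(2)[of L] by blast
    have q0: "0 < q" using q(1) by (rule primepow_gt_0_nat)
    define \<alpha> where "\<alpha> = card (reduced_exponents m (q - 1))"
    have "card (trits m a b) \<le> r * (Suc k * \<alpha>)"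
      using q(1,2) unfolding \<alpha>_def L_def
      by (intro proper_coloring_card_le[OF trits_subset q0 card_trits_avoiding_distance_le M n col]) auto
    then have N: "real (card (trits m a b)) \<le> real r * ((real k + 1) * real \<alpha>)"
      by (metis of_nat_Suc of_nat_le_iff of_nat_mult add.commute)
    \<comment> \<open>The monomial count is used with parameter \<open>x^2\<close>, giving the
      denominator \<open>1 + x^2 + x ^ 4\<close> and a power \<open>2 * (q - 1)\<close> of
      \<open>x\<close> that nearly cancels \<open>x ^ (a + 3 * b)\<close>.\<close>
    have "0 < x\<^sup>2" "x\<^sup>2 \<le> 1" using x by (auto simp: power_le_one)
    from card_reduced_exponents[OF this, of m "q - 1"]
    have \<alpha>: "real \<alpha> * x ^ (2 * (q - 1)) \<le> (1 + x\<^sup>2 + x ^ 4) ^ m"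
      by (simp add: \<alpha>_def power_mult)
    have e: "real (2 * (q - 1)) \<le> real L + 4 * \<epsilon> * real m + C"
    proof -
      have "\<epsilon> * real L \<le> \<epsilon> * (4 * real m)" using ab \<epsilon> by (intro mult_left_mono) (auto simp: L_def)
      then show ?thesis using q(3) q0 by (simp add: algebra_simps of_nat_diff)
    qed
    have "(1 + x + x ^ 3) ^ m * x ^ (2 * (q - 1))
       \<le> (real m + 1)\<^sup>2 * (real r * ((real k + 1) * real \<alpha>) * x ^ L) * x ^ (2 * (q - 1))"
      using x N by (intro mult_right_mono order_trans[OF ab(3)] mult_left_mono) (auto simp: L_def)
    also have "\<dots> = (real m + 1)\<^sup>2 * (real r * (real k + 1) * x ^ L) * (real \<alpha> * x ^ (2 * (q - 1)))"
      by (simp only: mult_ac)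
    also have "\<dots> \<le> (real m + 1)\<^sup>2 * (real r * (real k + 1) * x ^ L) * (1 + x\<^sup>2 + x ^ 4) ^ m"
      using x by (intro mult_left_mono \<alpha>) auto
    finally have 1: "(1 + x + x ^ 3) ^ m * x ^ (2 * (q - 1)) \<le> (real m + 1)\<^sup>2 * (real r * (real k + 1) * x ^ L) * (1 + x\<^sup>2 + x ^ 4) ^ m" .
    have pos: "0 < (1 + x\<^sup>2 + x ^ 4) ^ m" using x by (intro zero_less_power add_pos_pos) auto
    have "\<psi> ^ m * x ^ (2 * (q - 1)) \<le> (real m + 1)\<^sup>2 * (real r * (real k + 1) * x ^ L)"
      using 1 pos by (simp add: \<psi>_def power_divide divide_le_eq)
    moreover have "x powr (real L + 4 * \<epsilon> * real m + C) \<le> x ^ (2 * (q - 1))"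
      using x e by (simp only: powr_realpow[symmetric] powr_mono')
    ultimately have "\<psi> ^ m * x powr (real L + 4 * \<epsilon> * real m + C) \<le> (real m + 1)\<^sup>2 * (real r * (real k + 1) * x ^ L)"
      using \<psi>0 by (meson less_imp_le mult_left_mono order_trans zero_less_power)
    also have "x powr (real L + 4 * \<epsilon> * real m + C) = x ^ L * ((x powr (4 * \<epsilon>)) ^ m * x powr C)"
      using x by (simp add: powr_add powr_realpow powr_powr[symmetric])
    finally have "x ^ L * (\<beta>' ^ m * x powr C) \<le> x ^ L * ((real m + 1)\<^sup>2 * ((real k + 1) * real r))"
      by (simp add: \<beta>'_def power_mult_distrib mult_ac)
    then show ?thesis using x by simp
  qed
  have "0 < \<beta>'" "\<beta> < \<beta>'" using \<epsilon> \<beta> by (auto simp: \<beta>'_def)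
  then have "(\<lambda>m. E * ((real m + 1)\<^sup>2 * (\<beta> / \<beta>') ^ m)) \<longlonglongrightarrow> E * 0"
    using \<beta> by (intro tendsto_mult tendsto_const polynomial_times_power_tendsto_0) auto
  then have "\<forall>\<^sub>F m in sequentially. E * ((real m + 1)\<^sup>2 * (\<beta> / \<beta>') ^ m) < 1"
    by (intro order_tendstoD(2)) auto
  then show ?thesis
  proof (rule eventually_mono, intro allI impI)
    fix m n r c assume m: "E * ((real m + 1)\<^sup>2 * (\<beta> / \<beta>') ^ m) < 1"
      and n: "Suc k * m \<le> n" and col: "proper_coloring n d M r c"
    have pm: "0 < \<beta>' ^ m" using \<open>0 < \<beta>'\<close> by simp
    have "E * ((real m + 1)\<^sup>2 * \<beta> ^ m) < \<beta>' ^ m"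
      using m pm by (simp add: power_divide field_simps)
    then have "(K * (real k + 1)) * ((real m + 1)\<^sup>2 * \<beta> ^ m) \<le> \<beta>' ^ m * x powr C"
      using x by (simp add: E_def field_simps)
    also have "\<dots> \<le> (real m + 1)\<^sup>2 * ((real k + 1) * real r)" by (rule bound[OF n col])
    finally have "((real m + 1)\<^sup>2 * (real k + 1)) * (K * \<beta> ^ m) \<le> ((real m + 1)\<^sup>2 * (real k + 1)) * real r"
      by (simp only: mult_ac)
    moreover have "0 < (real m + 1)\<^sup>2 * (real k + 1)" by (intro mult_pos_pos zero_less_power) auto
    ultimately show "K * \<beta> ^ m \<le> real r" by (simp only: mult_le_cancel_left_pos)
  qed
qed

text \<open>Use blocks of length \<open>m = n div (k + 1)\<close>: growth \<open>\<beta> ^ m\<close>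
  with \<open>\<beta> = \<gamma> ^ (k + 1)\<close> is \<open>\<gamma> ^ n\<close> up to the
  remainder of the division.\<close>

lemma chromatic_number_unit_simplex_exp_lower_bound:
  assumes M: "unit_regular_simplex k d M"
  shows "exp_lower_bound (\<lambda>n. chromatic_number n d M) (psi2 powr (1 / (real k + 1)))"
proof (rule exp_lower_boundI)
  have psi2: "0 < psi2" using psi2_lower by (simp add: eval_nat_numeral)
  then show "0 < psi2 powr (1 / (real k + 1))" by simp
  fix \<gamma> assume \<gamma>: "0 < \<gamma>" "\<gamma> < psi2 powr (1 / (real k + 1))"
  have "\<gamma> ^ Suc k < (psi2 powr (1 / (real k + 1))) ^ Suc k"
    using \<gamma> by (intro power_strict_mono) auto
  also have "\<dots> = psi2"
    using psi2 by (simp add: powr_realpow[symmetric] powr_powr add.commute del: power_Suc)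
  finally have lt: "\<gamma> ^ Suc k < psi2" .
  \<comment> \<open>Bounds \<open>\<gamma> ^ (n mod Suc k)\<close>, whether \<open>\<gamma>\<close>
    is above or below 1.\<close>
  define K where "K = max 1 \<gamma> ^ k"
  have K: "0 < K" by (simp add: K_def)
  have "filterlim (\<lambda>n. n div Suc k) sequentially sequentially"
    unfolding filterlim_at_top
  proof
    fix Z
    show "\<forall>\<^sub>F n in sequentially. Z \<le> n div Suc k"
      using eventually_ge_at_top[of "Z * Suc k"]
      by (rule eventually_mono) (simp only: less_eq_div_iff_mult_less_eq zero_less_Suc)
  qed
  from eventually_compose_filterlim[OF proper_coloring_growth[OF M zero_less_power[OF \<gamma>(1)] lt K] this]
  show "\<forall>\<^sub>F n in sequentially. ereal (\<gamma> ^ n) \<le> ereal_of_enat (chromatic_number n d M)"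
  proof (rule eventually_mono)
    fix n assume n: "\<forall>n' r c. Suc k * (n div Suc k) \<le> n' \<longrightarrow> proper_coloring n' d M r c \<longrightarrow> K * (\<gamma> ^ Suc k) ^ (n div Suc k) \<le> real r"
    have "\<gamma> ^ n = \<gamma> ^ (Suc k * (n div Suc k) + n mod Suc k)" by (simp only: mult_div_mod_eq)
    also have "\<dots> = \<gamma> ^ (n mod Suc k) * (\<gamma> ^ Suc k) ^ (n div Suc k)"
      by (simp only: power_add power_mult mult.commute)
    also have "\<gamma> ^ (n mod Suc k) \<le> max 1 \<gamma> ^ (n mod Suc k)" using \<gamma> by (intro power_mono) auto
    also have "max 1 \<gamma> ^ (n mod Suc k) \<le> K" unfolding K_def
      by (intro power_increasing) (auto simp: less_Suc_eq_le[symmetric])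
    finally have "\<gamma> ^ n \<le> K * (\<gamma> ^ Suc k) ^ (n div Suc k)" using \<gamma> by (simp add: mult_right_mono)
    moreover have "Suc k * (n div Suc k) \<le> n" by (rule times_div_less_eq_dividend)
    ultimately show "ereal (\<gamma> ^ n) \<le> ereal_of_enat (chromatic_number n d M)"
      using n by (intro chromatic_number_ge) (blast intro: order_trans)
  qed
qed

lemma psi2_root_bounds:
  assumes "0 < j" "0 \<le> l" "l ^ j \<le> psi2" "0 \<le> u" "psi2 < u ^ j"
  shows "l \<le> psi2 powr (1 / real j)" "psi2 powr (1 / real j) < u"
proof -
  have psi2: "0 < psi2" using psi2_lower by (simp add: eval_nat_numeral)
  have eq: "(psi2 powr (1 / real j)) ^ j = psi2"
    using psi2 assms(1) by (simp add: powr_realpow[symmetric] powr_powr)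
  show "l \<le> psi2 powr (1 / real j)"
    by (rule power_le_imp_le_base[of _ "j - 1"]) (use assms eq in auto)
  show "psi2 powr (1 / real j) < u"
    by (rule power_less_imp_less_base[of _ j]) (use assms eq in auto)
qed

theorem theorem3:
  shows "1.239 \<le> psi2 \<and> psi2 < 1.240 \<and>
    (\<forall>k\<ge>1. \<forall>d M. unit_regular_simplex k d M \<longrightarrow>
       exp_lower_bound (\<lambda>n. chromatic_number n d M) (psi2 powr (1 / (real k + 1)))) \<and>
    (1.0742 \<le> psi2 powr (1 / 3) \<and> psi2 powr (1 / 3) < 1.0743 \<and>
      (\<forall>d M. unit_regular_simplex 2 d M \<longrightarrow>
         exp_lower_bound (\<lambda>n. chromatic_number n d M) (psi2 powr (1 / 3)))) \<and>
    (1.0551 \<le> psi2 powr (1 / 4) \<and> psi2 powr (1 / 4) < 1.0552 \<and>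
      (\<forall>d M. unit_regular_simplex 3 d M \<longrightarrow>
         exp_lower_bound (\<lambda>n. chromatic_number n d M) (psi2 powr (1 / 4))))"
proof -
  have "1.239 \<le> psi2" "psi2 < 1.240"
    using psi2_lower psi2_le by (simp_all add: eval_nat_numeral)
  moreover have "1.0742 \<le> psi2 powr (1 / 3)" "psi2 powr (1 / 3) < 1.0743"
    using psi2_root_bounds[of 3 "1.0742" "1.0743"] psi2_lower psi2_le by (simp_all add: eval_nat_numeral)
  moreover have "1.0551 \<le> psi2 powr (1 / 4)" "psi2 powr (1 / 4) < 1.0552"
    using psi2_root_bounds[of 4 "1.0551" "1.0552"] psi2_lower psi2_le by (simp_all add: eval_nat_numeral)
  moreover have "exp_lower_bound (\<lambda>n. chromatic_number n d M) (psi2 powr (1 / 3))" if "unit_regular_simplex 2 d M" for d M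
    using chromatic_number_unit_simplex_exp_lower_bound[OF that] by simp
  moreover have "exp_lower_bound (\<lambda>n. chromatic_number n d M) (psi2 powr (1 / 4))" if "unit_regular_simplex 3 d M" for d M
    using chromatic_number_unit_simplex_exp_lower_bound[OF that] by simp
  ultimately show ?thesis
    using chromatic_number_unit_simplex_exp_lower_bound by blast
qed

end
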